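(* Let $a,b$ be integers with $2\le a\le b$, let $p>0$ be real, let $q$ be an even integer with $2\le q\le a$, and let $$f(x,y)=x^ay^b+x^{a-q}y^{b}e^{-1/|y|^p}$$ (with $e^{-1/|y|^p}:=0$ at $y=0$). Let $U$ be a sufficiently small open neighborhood of the origin in $\mathbb{R}^2$, let $\varphi\in C_0^\infty(U)$ be real-valued, and let $Z_f(\varphi)(s)=\int_{\mathbb{R}^2}|f(x,y)|^s\varphi(x,y)\,dx\,dy$, which is holomorphic on $\mathrm{Re}(s)>0$. Then $Z_f(\varphi)(s)$ can be analytically continued as a meromorphic function, denoted again by $Z_f(\varphi)(s)$, to the half-plane $\mathrm{Re}(s)>-1/a$, and its poles there are contained in the set $\{-j/b: j\in\mathbb{N}\text{ with } j<b/a\}$ ($\mathbb{N}$ = positive integers). Moreover, with $\sigma$ real, the following hold. (i) If at least one of the two conditions (a) $0<p<b/a-1$; (b) $b/a$ is not an odd integer, is satisfied, then $$\lim_{\sigma\to -1/a+0}(a\sigma+1)^{1+\frac{b/a-1}{p}}\, Z_f(\varphi)(\sigma)=-4C\,\varphi(0,0),\qquad C=\frac{q^{(b/a-1)/p}}{b/a-1}\,\Gamma\!\left(1+\frac{b/a-1}{p}\right).$$ (ii) If $p=b/a-1$ and $b/a$ is an odd integer, then $$\lim_{\sigma\to -1/a+0}(a\sigma+1)^{2}\, Z_f(\varphi)(\sigma)=-\frac{4q}{p}\,\varphi(0,0)+\frac{4a}{b\,p!}\,\frac{\partial^{p}\varphi}{\partial y^{p}}(0,0).$$ (iii) If $p>b/a-1$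 and $b/a$ is an odd integer, then, with $m=b/a-1$, $$\lim_{\sigma\to -1/a+0}(a\sigma+1)^{2}\, Z_f(\varphi)(\sigma)=\frac{4a}{b\,m!}\,\frac{\partial^{m}\varphi}{\partial y^{m}}(0,0).$$
   Context: $\Gamma$ is the gamma function. $C_0^\infty(U)$ is the set of smooth ($C^\infty$) functions with compact support contained in $U$. "Sufficiently small" means contained in some ball about the origin whose radius depends only on $f$. The notation $\sigma\to -1/a+0$ means that the real variable $\sigma$ tends to $-1/a$ from the right. *)

theory Defs
  imports "HOL-Complex_Analysis.Complex_Analysis"
begin

definition flat_exp :: "real \<Rightarrow> real \<Rightarrow> real" where
  "flat_exp p y = (if y = 0 then 0 else exp (- 1 / \<bar>y\<bar> powr p))"

(* Natural-number subtraction in a - q is exact because q \<le> a is always assumed. *)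
definition phase :: "nat \<Rightarrow> nat \<Rightarrow> nat \<Rightarrow> real \<Rightarrow> real \<times> real \<Rightarrow> real" where
  "phase a b q p = (\<lambda>(x, y). x ^ a * y ^ b + x ^ (a - q) * y ^ b * flat_exp p y)"

primrec k_smooth ::
    "nat \<Rightarrow> ('a::real_normed_vector \<Rightarrow> 'b::real_normed_vector) \<Rightarrow> bool" where
  "k_smooth 0 f \<longleftrightarrow> continuous_on UNIV f"
| "k_smooth (Suc k) f \<longleftrightarrow>
     (\<forall>x. f differentiable (at x)) \<and>
     (\<forall>v. k_smooth k (\<lambda>x. frechet_derivative f (at x) v))"

definition smooth :: "('a::real_normed_vector \<Rightarrow> 'b::real_normed_vector) \<Rightarrow> bool" where
  "smooth f \<longleftrightarrow> (\<forall>k. k_smooth k f)"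

definition test_functions :: "(real \<times> real) set \<Rightarrow> (real \<times> real \<Rightarrow> real) set" where
  "test_functions U =
     {\<phi>. smooth \<phi> \<and> compact (closure (support_on UNIV \<phi>)) \<and> closure (support_on UNIV \<phi>) \<subseteq> U}"

(* The defining integral of Z_f(phi)(s); it is only used for Re s > 0. *)
definition local_zeta ::
    "(real \<times> real \<Rightarrow> real) \<Rightarrow> (real \<times> real \<Rightarrow> real) \<Rightarrow> complex \<Rightarrow> complex" where
  "local_zeta f \<phi> s =
     (LINT z|lborel. complex_of_real \<bar>f z\<bar> powr s * complex_of_real (\<phi> z))"

definition partial_y0 :: "nat \<Rightarrow> (real \<times> real \<Rightarrow> real) \<Rightarrow> real" where
  "partial_y0 m \<phi> = (deriv ^^ m) (\<lambda>y. \<phi> (0, y)) 0"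

definition odd_integer :: "real \<Rightarrow> bool" where
  "odd_integer x \<longleftrightarrow> (\<exists>k::int. odd k \<and> x = of_int k)"

definition leading_const :: "nat \<Rightarrow> nat \<Rightarrow> nat \<Rightarrow> real \<Rightarrow> real" where
  "leading_const a b q p =
     real q powr ((real b / real a - 1) / p) / (real b / real a - 1)
       * Gamma (1 + (real b / real a - 1) / p)"

end

theory Submission
  imports Defs "HOL-Real_Asymp.Real_Asymp"
begin

text \<open>Write $e(y) = e^{-1/|y|^p}$ for the flat function. Because $q$ is even, $|f|^s = |x|^{as}|y|^{bs}(1+r)^s$ with
$r = e(y)/x^q \ge 0$ off the null set $x = 0$, so the zeta integral is the sum of the
monomial integral $\int |x|^{as}|y|^{bs}\varphi$ and the flat part
$\int |x|^{as}|y|^{bs}((1+r)^s-1)\varphi$. The neighbourhood of the origin only has to force the support of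
$\varphi$ into the square $[-1,1]^2$, so radius 1 works.

The monomial integral is continued by Taylor expansion of $\varphi$ in $y$ to order $b$. The term of
degree $k$ contributes $\frac{1+(-1)^k}{k!\,(bs+k+1)}$ times a one-dimensional integral
$\int |x|^{as}\partial_y^k\varphi(x,0)\,dx$, which is holomorphic on $\mathrm{Re}(s)>-1/a$ and grows
like $2\,\partial_y^k\varphi(0,0)/(as+1)$ as $s$ approaches $-1/a$ from the right. The Taylor
remainder is $O(|y|^b)$, which compensates $|y|^{bs}$. This yields all the possible poles. At
$s=-1/a$ the factor $1/(bs+k+1)$ is singular only if $b/a=k+1$, and then the parity factor
requires $k$ to be even. This is the resonance, with $b/a$ an odd integer: the term then has order 2 in $1/(as+1)$.

The flat part is already holomorphic on $\mathrm{Re}(s)>-1/a$: for every small $\eta>0$ the bracket is at most a constant times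
$r^\eta(1+r)^{\max(0,\mathrm{Re}(s))}$ (lemma \<open>norm_of_real_powr_minus_1_le\<close>). The second factor is absorbed by $|x|^{as}$ (lemma
\<open>x_factor_bound\<close>), the first costs only $|x|^{-q\eta}$ in $x$ but gains $e(y)^\eta$, and a power of the flat function absorbs every negative power of $|y|$.

On the boundary the flat part has its own singularity. Put $\epsilon=a\sigma+1$. For
$|x|<e(y)^{1/q}$ the bracket is nearly $-1$, and outside that interval it is negligible; integrating
$|x|^{a\sigma}$ over the interval produces $-\frac{2}{\epsilon}\,e(y)^{\epsilon/q}\varphi(0,0)$ up to lower order
(lemma \<open>flat_perturbation_x_integral\<close>). It remains to understand $\int|y|^{b\sigma}e^{-(\epsilon/q)|y|^{-p}}dy$ as
$\epsilon\to 0$. The substitution $w=\tau y^{-p}$ turns it into an incomplete Gamma integral, so for $b>a$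
it behaves like a constant times $\epsilon^{-\delta}$ with $\delta=(b/a-1)/p$
(lemma \<open>flat_kernel_integral_tendsto\<close>).

So for $b>a$ the flat part has order $1+\delta$, for $a=b$ it has order less than 2, and the monomial part has order at most 2,
at most 1 without resonance. The three cases of the theorem compare $1+\delta$ with $2$: the flat part wins, both have order 2, or the
monomial part wins.\<close>

section \<open>Integrals depending holomorphically on a parameter\<close>

lemma norm_integral_le_integral:
  fixes f :: "'a \<Rightarrow> 'b::{banach, second_countable_topology}" and g :: "'a \<Rightarrow> real"
  assumes "integrable M f" "integrable M g" "\<And>x. norm (f x) \<le> g x"
  shows "norm (integral\<^sup>L M f) \<le> integral\<^sup>L M g"
proof -
  have "norm (integral\<^sup>L M f) \<le> (\<integral>x. norm (f x) \<partial>M)" by (rule integral_norm_bound)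
  also have "\<dots> \<le> integral\<^sup>L M g" using assms by (intro integral_mono) auto
  finally show ?thesis .
qed

text \<open>Cauchy's inequality on a smaller disc turns the local bound on the integrand into a bound on its derivative in the
parameter. That bound dominates the difference quotients, so dominated convergence differentiates under the integral sign.\<close>
lemma holomorphic_on_integral_dominated:
  fixes f :: "complex \<Rightarrow> 'a \<Rightarrow> complex"
  assumes "open S"
    and meas [measurable]: "\<And>s. f s \<in> borel_measurable M"
    and holo: "\<And>z. (\<lambda>s. f s z) holomorphic_on S"
    and dom: "\<And>s. s \<in> S \<Longrightarrow> \<exists>r>0. \<exists>g. integrable M g \<and> (\<forall>w\<in>ball s r. \<forall>z. norm (f w z) \<le> g z)"
  shows "(\<lambda>s. \<integral>z. f s z \<partial>M) holomorphic_on S"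
proof (rule holomorphic_onI)
  fix s0 assume s0: "s0 \<in> S"
  obtain r1 g where r1: "r1 > 0" and g: "integrable M g"
    and bd1: "\<And>w z. w \<in> ball s0 r1 \<Longrightarrow> norm (f w z) \<le> g z"
    using dom[OF s0] by blast
  obtain r2 where r2: "r2 > 0" "ball s0 r2 \<subseteq> S"
    using \<open>open S\<close> s0 open_contains_ball by blast
  define r where "r = min r1 r2 / 3"
  have r: "r > 0" "3 * r \<le> r1" "3 * r \<le> r2" using r1 r2 by (auto simp: r_def)
  have inS: "ball s0 (3*r) \<subseteq> S" using r(3) r2(2) by (meson dual_order.trans subset_ball)
  have bd: "norm (f w z) \<le> g z" if "w \<in> ball s0 (3*r)" for w z
    using bd1 that r(2) by auto
  have fd: "(\<lambda>s. f s z) field_differentiable at w" if "w \<in> ball s0 (3*r)" for w z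
    using holo[of z] that inS \<open>open S\<close> by (meson holomorphic_on_imp_differentiable_at subsetD)
  have deriv_bd: "norm (deriv (\<lambda>s. f s z) w) \<le> g z / r" if w: "w \<in> ball s0 r" for w z
  proof -
    have sub: "cball w r \<subseteq> ball s0 (3*r)"
    proof
      fix x assume "x \<in> cball w r"
      then have "dist w x \<le> r" by auto
      moreover have "dist s0 w < r" using w by auto
      ultimately have "dist s0 x < 3 * r" using dist_triangle[of s0 x w] r(1) by linarith
      then show "x \<in> ball s0 (3*r)" by simp
    qed
    have "norm ((deriv ^^ 1) (\<lambda>s. f s z) w) \<le> fact 1 * g z / r ^ 1"
    proof (rule Cauchy_inequality)
      show "(\<lambda>s. f s z) holomorphic_on ball w r"
        using holo sub inS by (meson ball_subset_cball holomorphic_on_subset order_trans)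
      show "continuous_on (cball w r) (\<lambda>s. f s z)"
        using holo sub inS by (meson holomorphic_on_imp_continuous_on holomorphic_on_subset order_trans)
      show "norm (f x z) \<le> g z" if "norm (w - x) = r" for x
        using bd[of x z] sub that by (auto simp: dist_norm subset_iff)
    qed (use r in auto)
    then show ?thesis by simp
  qed
  have lip: "norm (f w z - f s0 z) \<le> g z / r * norm (w - s0)" if w: "w \<in> ball s0 r" for w z
  proof (rule field_differentiable_bound[where S = "ball s0 r" and f' = "deriv (\<lambda>s. f s z)"])
    show "((\<lambda>s. f s z) has_field_derivative deriv (\<lambda>s. f s z) x) (at x within ball s0 r)"
      if "x \<in> ball s0 r" for x
      using fd[of x z] that r(1)
      by (auto intro!: DERIV_subset[OF field_differentiable_derivI])
  qed (use w r deriv_bd in auto)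
  define D where "D = (\<integral>z. deriv (\<lambda>s. f s z) s0 \<partial>M)"
  have int_f: "integrable M (f w)" if "w \<in> ball s0 r" for w
    by (rule Bochner_Integration.integrable_bound[OF g]) (use bd[of w] that r(1) in \<open>auto intro!: AE_I2 order_trans[OF bd abs_ge_self]\<close>)
  \<comment> \<open>Sequences suffice; those terms that leave the disc, finitely many, are moved to a fixed point of it, so that the
    domination holds for every index.\<close>
  have "((\<lambda>y. ((\<integral>z. f y z \<partial>M) - (\<integral>z. f s0 z \<partial>M)) / (y - s0)) \<longlongrightarrow> D) (at s0)"
    unfolding tendsto_at_iff_sequentially
  proof (intro allI impI)
    fix X :: "nat \<Rightarrow> complex" assume X: "\<forall>i. X i \<in> UNIV - {s0}" "X \<longlonglongrightarrow> s0"
    define Y where "Y n = (if X n \<in> ball s0 r then X n else s0 + of_real (r/2))" for n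
    have ev: "eventually (\<lambda>n. X n = Y n) sequentially"
      using topological_tendstoD[OF X(2) open_ball, of s0 r] r(1) by (auto simp: Y_def elim!: eventually_mono)
    have Yne: "Y n \<noteq> s0" for n using X(1) r(1) by (auto simp: Y_def)
    have Yin: "Y n \<in> ball s0 r" for n using r(1) by (auto simp: Y_def dist_norm)
    have Ylim: "Y \<longlonglongrightarrow> s0" using X(2) ev by (rule Lim_transform_eventually)
    have Yat: "filterlim Y (at s0) sequentially"
      using Ylim Yne by (simp add: filterlim_at)
    have ptw: "(\<lambda>n. (f (Y n) z - f s0 z) / (Y n - s0)) \<longlonglongrightarrow> deriv (\<lambda>s. f s z) s0" for z
    proof -
      have "((\<lambda>s. f s z) has_field_derivative deriv (\<lambda>s. f s z) s0) (at s0)"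
        using fd[of s0 z] r(1) by (auto intro: field_differentiable_derivI)
      then have "((\<lambda>y. (f y z - f s0 z) / (y - s0)) \<longlongrightarrow> deriv (\<lambda>s. f s z) s0) (at s0)"
        by (simp add: has_field_derivative_iff)
      from filterlim_compose[OF this Yat] show ?thesis .
    qed
    have "(\<lambda>n. \<integral>z. (f (Y n) z - f s0 z) / (Y n - s0) \<partial>M) \<longlonglongrightarrow> D"
      unfolding D_def
    proof (rule integral_dominated_convergence)
      show "(\<lambda>z. deriv (\<lambda>s. f s z) s0) \<in> borel_measurable M"
        by (rule borel_measurable_LIMSEQ_metric[OF _ ptw]) measurable
      show "integrable M (\<lambda>z. g z / r)" using g by simp
      show "AE z in M. norm ((f (Y n) z - f s0 z) / (Y n - s0)) \<le> g z / r" for n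
      proof (rule AE_I2)
        fix z
        show "norm ((f (Y n) z - f s0 z) / (Y n - s0)) \<le> g z / r"
          using lip[OF Yin, of n z] Yne[of n] by (simp add: norm_divide field_simps)
      qed
      show "AE z in M. (\<lambda>n. (f (Y n) z - f s0 z) / (Y n - s0)) \<longlonglongrightarrow> deriv (\<lambda>s. f s z) s0"
        using ptw by simp
    qed measurable
    moreover have "(\<integral>z. (f (Y n) z - f s0 z) / (Y n - s0) \<partial>M)
       = ((\<integral>z. f (Y n) z \<partial>M) - (\<integral>z. f s0 z \<partial>M)) / (Y n - s0)" for n
      using int_f[OF Yin] int_f[of s0] r(1) by simp
    ultimately have "(\<lambda>n. ((\<integral>z. f (Y n) z \<partial>M) - (\<integral>z. f s0 z \<partial>M)) / (Y n - s0)) \<longlonglongrightarrow> D"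
      by (simp only:)
    then show "((\<lambda>y. ((\<integral>z. f y z \<partial>M) - (\<integral>z. f s0 z \<partial>M)) / (y - s0)) \<circ> X) \<longlonglongrightarrow> D"
      by (rule Lim_transform_eventually) (use ev in \<open>auto elim!: eventually_mono\<close>)
  qed
  then have "((\<lambda>s. \<integral>z. f s z \<partial>M) has_field_derivative D) (at s0)"
    by (simp add: has_field_derivative_iff)
  then show "(\<lambda>s. \<integral>z. f s z \<partial>M) field_differentiable at s0 within S"
    using field_differentiable_def field_differentiable_at_within by blast
qed

lemma borel_measurable_of_real_powr [measurable (raw)]:
  fixes g :: "'a \<Rightarrow> real"
  assumes [measurable]: "g \<in> borel_measurable M" 
  shows "(\<lambda>z. complex_of_real \<bar>g z\<bar> powr s) \<in> borel_measurable M"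
proof -
  have "(\<lambda>z. complex_of_real \<bar>g z\<bar> powr s) =
     (\<lambda>z. if g z = 0 then 0 else exp (s * complex_of_real (ln \<bar>g z\<bar>)))"
    by (auto simp: powr_def Ln_of_real fun_eq_iff)
  then show ?thesis by simp
qed

lemma norm_of_real_abs_powr: "norm (complex_of_real \<bar>u\<bar> powr s) = \<bar>u\<bar> powr Re s"
  by (subst norm_powr_real_powr) auto

section \<open>Power integrals\<close>

lemma has_bochner_integral_powr_from_0:
  fixes c r :: real
  assumes "c > -1" "r \<ge> 0"
  shows "has_bochner_integral lborel (\<lambda>x. indicator {0..r} x *\<^sub>R x powr c) (r powr (c + 1) / (c + 1))"
proof -
  have hi: "((\<lambda>x. x powr c) has_integral (r powr (c + 1) / (c + 1))) {0..r}"
    using assms by (rule has_integral_powr_from_0)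
  then have "(\<lambda>x. x powr c) absolutely_integrable_on {0..r}"
    by (intro nonnegative_absolutely_integrable_1) auto
  then have int: "set_integrable lborel {0..r} (\<lambda>x. x powr c)"
    unfolding set_integrable_def by (subst (asm) integrable_completion) auto
  have "(LINT x:{0..r}|lborel. x powr c) = r powr (c + 1) / (c + 1)"
    using set_borel_integral_eq_integral(2)[OF int] hi by (simp add: integral_unique)
  with int show ?thesis
    by (simp add: has_bochner_integral_iff set_integrable_def set_lebesgue_integral_def)
qed

lemma has_bochner_integral_abs_powr:
  fixes c r :: real
  assumes "c > -1" "r \<ge> 0"
  shows "has_bochner_integral lborel (\<lambda>x. indicator {-r..r} x * \<bar>x\<bar> powr c) (2 * r powr (c + 1) / (c + 1))"
proof -
  have eq: "(\<lambda>x. indicator {0..} x *\<^sub>R (indicator {-r..r} x * \<bar>x\<bar> powr c)) = (\<lambda>x. indicator {0..r} x *\<^sub>R x powr c)"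
    using assms by (auto simp: fun_eq_iff indicator_def)
  have "has_bochner_integral lborel (\<lambda>x. indicator {-r..r} x * \<bar>x\<bar> powr c) (2 *\<^sub>R (r powr (c + 1) / (c + 1)))"
    by (rule has_bochner_integral_even_function, subst eq, rule has_bochner_integral_powr_from_0)
       (use assms in \<open>auto simp: indicator_def\<close>)
  then show ?thesis by simp
qed

lemma has_bochner_integral_abs_powr_outside:
  fixes c r :: real
  assumes "c < -1" "0 < r" "r \<le> 1"
  shows "has_bochner_integral lborel (\<lambda>x. (indicator {-1..1} x - indicator {-r..r} x) * \<bar>x\<bar> powr c)
     (2 * (r powr (c + 1) - 1) / (- c - 1))"
proof -
  let ?f = "\<lambda>x::real. (indicator {-1..1} x - indicator {-r..r} x) * \<bar>x\<bar> powr c"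
  have "has_bochner_integral lborel (\<lambda>x. x powr c * indicator {r..1} x) (1 powr (c + 1) / (c + 1) - r powr (c + 1) / (c + 1))"
  proof (rule has_bochner_integral_FTC_Icc_real)
    fix x assume "r \<le> x" "x \<le> 1"
    then show "((\<lambda>x. x powr (c + 1) / (c + 1)) has_real_derivative x powr c) (at x)" "isCont (\<lambda>x. x powr c) x"
      using assms by (auto intro!: derivative_eq_intros continuous_intros)
  qed (use assms in auto)
  moreover have "1 powr (c + 1) / (c + 1) - r powr (c + 1) / (c + 1) = (r powr (c + 1) - 1) / (- c - 1)"
    using assms by (simp add: divide_simps) algebra
  ultimately have "has_bochner_integral lborel (\<lambda>x. x powr c * indicator {r..1} x) ((r powr (c + 1) - 1) / (- c - 1))"
    by (simp only:)
  moreover have "AE x in lborel. x powr c * indicator {r..1} x = indicator {0..} x *\<^sub>R ?f x"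
    using AE_lborel_singleton[of r] by eventually_elim (use assms in \<open>auto simp: indicator_def\<close>)
  ultimately have "has_bochner_integral lborel (\<lambda>x. indicator {0..} x *\<^sub>R ?f x) ((r powr (c + 1) - 1) / (- c - 1))"
    by (subst (asm) has_bochner_integral_cong_AE) auto
  then have "has_bochner_integral lborel ?f (2 *\<^sub>R ((r powr (c + 1) - 1) / (- c - 1)))"
    by (rule has_bochner_integral_even_function) (auto simp: indicator_def)
  then show ?thesis by simp
qed

lemma has_bochner_integral_of_real_powr_from_0:
  fixes c :: complex
  assumes "Re c > -1"
  shows "has_bochner_integral lborel (\<lambda>x. indicator {0..1::real} x *\<^sub>R of_real \<bar>x\<bar> powr c) (1 / (c + 1))"
proof -
  have c1: "c + 1 \<noteq> 0" using assms by (auto simp: complex_eq_iff)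
  have "((\<lambda>x. of_real x powr c) has_integral (of_real 1 powr (c+1) / (c+1) - of_real 0 powr (c+1) / (c+1))) {0..1::real}"
  proof (rule fundamental_theorem_of_calculus_interior)
    show "continuous_on {0..1} (\<lambda>x::real. complex_of_real x powr (c + 1) / (c + 1))"
      using assms c1 by (intro continuous_intros continuous_on_powr_complex) auto
    fix x :: real assume "x \<in> {0<..<1}"
    then show "((\<lambda>x. complex_of_real x powr (c+1) / (c+1)) has_vector_derivative of_real x powr c) (at x)"
      using c1 by (auto intro!: derivative_eq_intros has_vector_derivative_real_field simp: )
  qed auto
  then have hi: "((\<lambda>x. complex_of_real \<bar>x\<bar> powr c) has_integral (1 / (c+1))) {0..1::real}"
    by (subst has_integral_cong[where g = "\<lambda>x. of_real x powr c"]) auto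
  have int: "set_integrable lborel {0..1} (\<lambda>x. complex_of_real \<bar>x\<bar> powr c)"
    unfolding set_integrable_def
  proof (rule Bochner_Integration.integrable_bound)
    show "integrable lborel (\<lambda>x. indicator {0..1} x *\<^sub>R x powr Re c)"
      using has_bochner_integral_powr_from_0[of "Re c" 1] assms by (auto simp: has_bochner_integral_iff)
  qed (auto simp: norm_of_real_abs_powr indicator_def)
  have "(LINT x:{0..1}|lborel. complex_of_real \<bar>x\<bar> powr c) = 1 / (c + 1)"
    using set_borel_integral_eq_integral(2)[OF int] hi by (simp add: integral_unique)
  with int show ?thesis
    by (simp add: has_bochner_integral_iff set_integrable_def set_lebesgue_integral_def)
qed

text \<open>The integrand is even or odd according to the parity of the monomial, so
the two halves either double or cancel. This is the source of the poles in the variable $y$ and of their parity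
restriction.\<close>
lemma has_bochner_integral_of_real_powr_monomial:
  fixes c :: complex
  assumes "Re c + real k > -1"
  shows "has_bochner_integral lborel (\<lambda>x. indicator {-1..1::real} x *\<^sub>R (of_real \<bar>x\<bar> powr c * of_real (x ^ k)))
     ((1 + (-1) ^ k) / (c + of_nat k + 1))"
proof -
  have pk: "of_real x powr c * of_real x ^ k = complex_of_real x powr (c + of_nat k)" if "x \<ge> 0" for x :: real
    using that by (cases "x = 0") (auto simp: powr_add powr_nat')
  have eq: "(\<lambda>x. indicator {0..} x *\<^sub>R (indicator {-1..1::real} x *\<^sub>R (of_real \<bar>x\<bar> powr c * of_real (x ^ k))))
     = (\<lambda>x. indicator {0..1::real} x *\<^sub>R complex_of_real \<bar>x\<bar> powr (c + of_nat k))"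
    by (auto simp: fun_eq_iff indicator_def pk)
  have half: "has_bochner_integral lborel
     (\<lambda>x. indicator {0..} x *\<^sub>R (indicator {-1..1::real} x *\<^sub>R (complex_of_real \<bar>x\<bar> powr c * of_real (x ^ k)))) (1 / (c + of_nat k + 1))"
    unfolding eq using has_bochner_integral_of_real_powr_from_0[of "c + of_nat k"] assms by simp
  show ?thesis
  proof (cases "even k")
    case True
    then have "indicator {-1..1} (-x) *\<^sub>R (complex_of_real \<bar>-x\<bar> powr c * of_real ((-x) ^ k)) =
      indicator {-1..1} x *\<^sub>R (complex_of_real \<bar>x\<bar> powr c * of_real (x ^ k))" for x :: real
      by (auto simp: indicator_def)
    from has_bochner_integral_even_function[OF half this] True show ?thesis
      by (simp add: scaleR_conv_of_real)
  next
    case False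
    then have "indicator {-1..1} (-x) *\<^sub>R (complex_of_real \<bar>-x\<bar> powr c * of_real ((-x) ^ k)) =
      - (indicator {-1..1} x *\<^sub>R (complex_of_real \<bar>x\<bar> powr c * of_real (x ^ k)))" for x :: real
      by (auto simp: indicator_def)
    from has_bochner_integral_odd_function[OF half this] False show ?thesis
      by simp
  qed
qed

section \<open>Smooth functions along lines\<close>

text \<open>Iterating this operator stays within the smooth functions, and along a fixed line it is the ordinary
derivative. Both the Taylor expansion in $y$ and the Lipschitz bounds in $x$ and $y$ are instances of one-variable statements about it.\<close>
definition dir_deriv :: "'a::real_normed_vector \<Rightarrow> ('a \<Rightarrow> real) \<Rightarrow> 'a \<Rightarrow> real" where
  "dir_deriv v f = (\<lambda>z. frechet_derivative f (at z) v)"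

lemma smooth_dir_deriv: "smooth f \<Longrightarrow> smooth (dir_deriv v f)"
  unfolding smooth_def dir_deriv_def by (metis k_smooth.simps(2))

lemma smooth_iter_dir_deriv: "smooth f \<Longrightarrow> smooth ((dir_deriv v ^^ n) f)"
  by (induction n) (auto intro: smooth_dir_deriv)

lemma smooth_imp_continuous_on: "smooth f \<Longrightarrow> continuous_on S f"
  unfolding smooth_def by (metis continuous_on_subset k_smooth.simps(1) subset_UNIV)

lemma smooth_imp_borel_measurable: "smooth f \<Longrightarrow> f \<in> borel_measurable borel"
  by (intro borel_measurable_continuous_onI smooth_imp_continuous_on)

lemma smooth_bounded_on_compact:
  fixes f :: "'a::real_normed_vector \<Rightarrow> real"
  assumes "smooth f" "compact K"
  obtains B where "B \<ge> 0" "\<And>z. z \<in> K \<Longrightarrow> \<bar>f z\<bar> \<le> B"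
proof -
  have "bounded (f ` K)"
    using assms by (intro compact_imp_bounded compact_continuous_image smooth_imp_continuous_on)
  then obtain B where "\<And>z. z \<in> K \<Longrightarrow> \<bar>f z\<bar> \<le> B" 
    unfolding bounded_iff by auto
  then show thesis by (intro that[of "max 0 B"]) (auto simp: max.coboundedI2)
qed

lemma smooth_has_derivative_along_line:
  assumes "smooth f"
  shows "((\<lambda>t. f (z + t *\<^sub>R v)) has_real_derivative dir_deriv v f (z + t *\<^sub>R v)) (at t)"
proof -
  have "k_smooth (Suc 0) f" using assms by (simp only: smooth_def)
  then have "f differentiable (at (z + t *\<^sub>R v))" by simp
  then have d: "(f has_derivative frechet_derivative f (at (z + t *\<^sub>R v))) (at (z + t *\<^sub>R v))"
    by (simp add: frechet_derivative_works)
  have "((\<lambda>t. f (z + t *\<^sub>R v)) has_derivative (\<lambda>h. frechet_derivative f (at (z + t *\<^sub>R v)) (h *\<^sub>R v))) (at t)"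
    by (rule has_derivative_compose[of "\<lambda>t. z + t *\<^sub>R v" "\<lambda>h. h *\<^sub>R v" t UNIV f, OF _ d])
       (auto intro!: derivative_eq_intros)
  moreover have "(\<lambda>h. frechet_derivative f (at (z + t *\<^sub>R v)) (h *\<^sub>R v)) = (*) (dir_deriv v f (z + t *\<^sub>R v))"
    using linear_cmul[OF has_derivative_linear[OF d]] by (auto simp: dir_deriv_def)
  ultimately show ?thesis by (simp add: has_field_derivative_def)
qed

lemma smooth_Taylor_along_line:
  assumes "smooth f"
  shows "\<exists>t. \<bar>t\<bar> \<le> \<bar>h\<bar> \<and> f (z + h *\<^sub>R v) =
     (\<Sum>m<n. (dir_deriv v ^^ m) f z / fact m * h ^ m) + (dir_deriv v ^^ n) f (z + t *\<^sub>R v) / fact n * h ^ n"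
  using Maclaurin_all_le[of "\<lambda>m t. (dir_deriv v ^^ m) f (z + t *\<^sub>R v)" "\<lambda>t. f (z + t *\<^sub>R v)" h n]
    smooth_has_derivative_along_line[OF smooth_iter_dir_deriv[OF assms]] by simp

lemma smooth_iter_deriv_along_line:
  assumes "smooth f"
  shows "(deriv ^^ n) (\<lambda>t. f (z + t *\<^sub>R v)) = (\<lambda>t. (dir_deriv v ^^ n) f (z + t *\<^sub>R v))"
proof (induction n)
  case (Suc n)
  then show ?case
    using DERIV_imp_deriv[OF smooth_has_derivative_along_line[OF smooth_iter_dir_deriv[OF assms, of n]]]
    by (simp only: funpow.simps o_apply)
qed simp

text \<open>Walk from the origin first along the $y$-axis and then parallel to the $x$-axis, applying the mean value theorem to each leg.\<close>
lemma smooth_difference_bound: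
  assumes "smooth f"
  obtains L where "L \<ge> 0" "\<And>x y. x \<in> {-1..1} \<Longrightarrow> y \<in> {-1..1} \<Longrightarrow> \<bar>f (x, y) - f (0, 0 :: real)\<bar> \<le> L * \<bar>x :: real\<bar> + L * \<bar>y\<bar>"
proof -
  have K: "compact ({-1..1} \<times> {-1..1} :: (real \<times> real) set)" by (intro compact_Times) auto
  obtain L1 where L1: "L1 \<ge> 0" "\<And>z. z \<in> {-1..1} \<times> {-1..1} \<Longrightarrow> \<bar>dir_deriv (1,0) f z\<bar> \<le> L1"
    using smooth_bounded_on_compact[OF smooth_dir_deriv[OF assms] K] by blast
  obtain L2 where L2: "L2 \<ge> 0" "\<And>z. z \<in> {-1..1} \<times> {-1..1} \<Longrightarrow> \<bar>dir_deriv (0,1) f z\<bar> \<le> L2"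
    using smooth_bounded_on_compact[OF smooth_dir_deriv[OF assms] K] by blast
  show thesis
  proof (rule that[of "max L1 L2"])
    fix x y :: real assume xy: "x \<in> {-1..1}" "y \<in> {-1..1}"
    from smooth_Taylor_along_line[OF assms, of x "(0, y)" "(1, 0)" 1]
    obtain t where t: "\<bar>t\<bar> \<le> \<bar>x\<bar>" "f (x, y) - f (0, y) = dir_deriv (1, 0) f (t, y) * x" by auto
    from smooth_Taylor_along_line[OF assms, of y "(0, 0)" "(0, 1)" 1]
    obtain u where u: "\<bar>u\<bar> \<le> \<bar>y\<bar>" "f (0, y) - f (0, 0) = dir_deriv (0, 1) f (0, u) * y" by auto
    have tu: "t \<in> {-1..1}" "u \<in> {-1..1}" using t(1) u(1) xy by (auto simp: abs_if split: if_splits)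
    have "\<bar>f (x, y) - f (0, y)\<bar> \<le> max L1 L2 * \<bar>x\<bar>"
      unfolding t(2) abs_mult using L1(2)[of "(t, y)"] tu xy by (intro mult_right_mono) auto
    moreover have "\<bar>f (0, y) - f (0, 0)\<bar> \<le> max L1 L2 * \<bar>y\<bar>"
      unfolding u(2) abs_mult using L2(2)[of "(0, u)"] tu xy by (intro mult_right_mono) auto
    ultimately show "\<bar>f (x, y) - f (0, 0)\<bar> \<le> max L1 L2 * \<bar>x\<bar> + max L1 L2 * \<bar>y\<bar>" by linarith
  qed (use L1 in auto)
qed

section \<open>The flat kernel\<close>

lemma flat_exp_bounds: "0 \<le> flat_exp p y" "flat_exp p y \<le> 1"
  by (auto simp: flat_exp_def)

lemma flat_exp_pos: "y \<noteq> 0 \<Longrightarrow> 0 < flat_exp p y"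
  by (auto simp: flat_exp_def)

lemma borel_measurable_flat_exp [measurable]: "flat_exp p \<in> borel_measurable borel"
  unfolding flat_exp_def by measurable

text \<open>Raise the tangent line bound $u/\eta\le e^{u/\eta}$ to the power $\eta$.\<close>
lemma exp_minus_le_powr:
  fixes u \<eta> :: real
  assumes "u > 0" "\<eta> > 0"
  shows "exp (- u) \<le> \<eta> powr \<eta> * u powr (- \<eta>)"
proof -
  have "u / \<eta> \<le> exp (u / \<eta>)" using exp_ge_add_one_self[of "u / \<eta>"] by linarith
  then have "(u / \<eta>) powr \<eta> \<le> exp (u / \<eta>) powr \<eta>"
    using assms by (intro powr_mono2) auto
  also have "\<dots> = exp u" using assms by (simp add: powr_def)
  finally show ?thesis using assms by (simp add: powr_divide powr_minus exp_minus divide_simps mult.commute)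
qed

lemma flat_exp_powr: "y \<noteq> 0 \<Longrightarrow> flat_exp p y powr \<tau> = exp (- (\<tau> / \<bar>y\<bar> powr p))"
  by (simp add: flat_exp_def powr_def)

text \<open>Every power of the flat function beats every power of $|y|$, with an explicit price in the exponent
\<open>\<tau>\<close>. The price $\tau^{-\eta}$ measures the growth of kernel integrals as \<open>\<tau>\<close> tends to zero.\<close>
lemma flat_exp_powr_le:
  assumes "\<tau> > 0" "\<eta> > 0"
  shows "flat_exp p y powr \<tau> \<le> \<eta> powr \<eta> * \<tau> powr (- \<eta>) * \<bar>y\<bar> powr (p * \<eta>)"
proof (cases "y = 0")
  case False
  have "flat_exp p y powr \<tau> \<le> \<eta> powr \<eta> * (\<tau> / \<bar>y\<bar> powr p) powr (- \<eta>)"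
    using exp_minus_le_powr[of "\<tau> / \<bar>y\<bar> powr p" \<eta>] assms False by (simp add: flat_exp_powr)
  also have "(\<tau> / \<bar>y\<bar> powr p) powr (- \<eta>) = \<tau> powr (- \<eta>) * \<bar>y\<bar> powr (p * \<eta>)"
    using assms False by (simp add: powr_divide powr_powr powr_minus divide_simps)
  finally show ?thesis by (simp add: mult.assoc)
qed (simp add: flat_exp_def)

lemma flat_kernel_integral_le:
  fixes p \<eta> \<mu>0 \<mu> \<tau> :: real
  assumes "\<eta> > 0" "\<mu>0 + p * \<eta> > -1" "\<mu> \<ge> \<mu>0" "\<tau> > 0"
  shows "integrable lborel (\<lambda>y. indicator {-1..1} y * (\<bar>y\<bar> powr \<mu> * flat_exp p y powr \<tau>))" (is "integrable _ ?f")
    and "(\<integral>y. indicator {-1..1} y * (\<bar>y\<bar> powr \<mu> * flat_exp p y powr \<tau>) \<partial>lborel)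
       \<le> 2 * \<eta> powr \<eta> / (\<mu>0 + p * \<eta> + 1) * \<tau> powr (- \<eta>)"
proof -
  define C where "C = \<eta> powr \<eta> * \<tau> powr (- \<eta>)"
  let ?g = "\<lambda>y::real. C * (indicator {-1..1} y * \<bar>y\<bar> powr (\<mu>0 + p * \<eta>))"
  have hb: "has_bochner_integral lborel ?g (C * (2 * 1 powr (\<mu>0 + p * \<eta> + 1) / (\<mu>0 + p * \<eta> + 1)))"
    using has_bochner_integral_abs_powr[of "\<mu>0 + p * \<eta>" 1] assms(2) by (intro has_bochner_integral_mult_right) auto
  have le: "?f y \<le> ?g y" for y
  proof (cases "y \<in> {-1..1} - {0}")
    case True
    have "\<bar>y\<bar> powr \<mu> * flat_exp p y powr \<tau> \<le> \<bar>y\<bar> powr \<mu>0 * (C * \<bar>y\<bar> powr (p * \<eta>))"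
      using True flat_exp_powr_le[OF assms(4,1), of p y] assms(3)
      by (intro mult_mono powr_mono') (auto simp: C_def)
    with True show ?thesis by (simp add: powr_add mult_ac)
  qed (auto simp: indicator_def)
  have nn: "0 \<le> ?f y" for y by (auto simp: indicator_def)
  show int: "integrable lborel ?f"
  proof (rule Bochner_Integration.integrable_bound)
    show "integrable lborel ?g" using hb by (simp add: has_bochner_integral_iff)
    show "AE y in lborel. norm (?f y) \<le> norm (?g y)"
      using le nn by (intro AE_I2) (metis abs_of_nonneg order_trans real_norm_def)
  qed measurable
  have "integral\<^sup>L lborel ?f \<le> integral\<^sup>L lborel ?g"
    using int hb le by (intro integral_mono) (auto simp: has_bochner_integral_iff)
  also have "\<dots> = C * (2 * 1 powr (\<mu>0 + p * \<eta> + 1) / (\<mu>0 + p * \<eta> + 1))"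
    using hb by (simp add: has_bochner_integral_iff)
  also have "\<dots> = 2 * \<eta> powr \<eta> / (\<mu>0 + p * \<eta> + 1) * \<tau> powr (- \<eta>)"
    using assms(2) by (simp add: C_def)
  finally show "integral\<^sup>L lborel ?f \<le> 2 * \<eta> powr \<eta> / (\<mu>0 + p * \<eta> + 1) * \<tau> powr (- \<eta>)" .
qed

text \<open>The substitution $w=\tau y^{-p}$ maps $(0,1]$ onto $[\tau,\infty)$ and turns the kernel into the integrand of an incomplete Gamma function.\<close>
lemma flat_kernel_integral_half:
  fixes p \<mu> \<tau> :: real
  assumes p: "p > 0" and \<tau>: "\<tau> > 0" and nu: "- (\<mu> + 1) / p > 0"
  shows "has_bochner_integral lborel (\<lambda>y. indicator {0..1} y *\<^sub>R (y powr \<mu> * flat_exp p y powr \<tau>))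
     (\<tau> powr ((\<mu> + 1) / p) / p * (\<integral>w. indicator {\<tau>..} w * (w powr (- (\<mu> + 1) / p - 1) * exp (- w)) \<partial>lborel))"
proof -
  define \<nu> where "\<nu> = - (\<mu> + 1) / p"
  define f where "f w = w powr (\<nu> - 1) * exp (- w)" for w
  define g where "g y = \<tau> * y powr (- p)" for y
  define c where "c = \<tau> powr (- \<nu>) / p"
  have nu_eq: "(\<mu> + 1) / p = - \<nu>" using p by (simp add: \<nu>_def field_simps)
  have \<nu>: "\<nu> > 0" using nu by (simp add: \<nu>_def)
  have c: "c > 0" using p \<tau> by (simp add: c_def)
  have fint0: "f absolutely_integrable_on {0..}"
    using Gamma_integral_real[OF \<nu>] unfolding f_def
    by (intro nonnegative_absolutely_integrable_1) (auto simp: exp_minus field_simps has_integral_integrable)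
  then have fint: "f absolutely_integrable_on {\<tau>..}"
    by (rule set_integrable_subset) (use \<tau> in auto)
  have img: "g ` {0<..1} = {\<tau>..}"
  proof (intro equalityI subsetI)
    fix w assume "w \<in> g ` {0<..1}"
    then obtain y where y: "0 < y" "y \<le> 1" "w = \<tau> * y powr (- p)" by (auto simp: g_def)
    have "y powr (- p) \<ge> 1" using y p by (simp add: powr_minus field_simps powr_le1)
    with y \<tau> show "w \<in> {\<tau>..}" by simp
  next
    fix w assume w: "w \<in> {\<tau>..}"
    define y where "y = (\<tau> / w) powr (1 / p)"
    have "y powr (- p) = w / \<tau>" using w \<tau> p by (simp add: y_def powr_powr powr_minus)
    moreover have "0 < y" "y \<le> 1" using w \<tau> p by (auto simp: y_def intro!: powr_le1)
    ultimately show "w \<in> g ` {0<..1}" using \<tau> by (intro image_eqI[of _ _ y]) (auto simp: g_def)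
  qed
  have inj: "inj_on g {0<..1}"
    using p \<tau> by (auto simp: g_def inj_on_def powr_minus)
      (metis less_eq_real_def less_irrefl powr_less_mono2 linorder_neqE_linordered_idom)
  have der: "(g has_field_derivative - (p * \<tau> * y powr (- p - 1))) (at y within {0<..1})" if "y \<in> {0<..1}" for y
    unfolding g_def using that by (auto intro!: derivative_eq_intros)
  define F where "F y = \<bar>- (p * \<tau> * y powr (- p - 1))\<bar> * (c * f (g y))" for y
  have key: "F y = y powr \<mu> * flat_exp p y powr \<tau>"
    if y: "y \<in> {0<..1}" for y
  proof -
    have e: "exp (- g y) = flat_exp p y powr \<tau>"
      using y by (simp add: g_def flat_exp_powr powr_minus divide_simps)
    have "p * \<nu> = - \<mu> - 1" using p by (simp add: \<nu>_def field_simps)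
    then have ex: "- p - 1 + (- p) * (\<nu> - 1) = \<mu>" by (simp add: algebra_simps)
    have "F y
       = (\<tau> * \<tau> powr (- \<nu>) * \<tau> powr (\<nu> - 1)) * (y powr (- p - 1) * y powr ((- p) * (\<nu> - 1))) * exp (- g y)"
      using y p \<tau> by (simp add: F_def c_def f_def g_def powr_mult powr_powr abs_mult)
    also have "\<tau> * \<tau> powr (- \<nu>) * \<tau> powr (\<nu> - 1) = \<tau> powr (1 + (- \<nu>) + (\<nu> - 1))"
      using \<tau> by (simp only: powr_add) simp
    also have "\<dots> = 1" using \<tau> by simp
    also have "y powr (- p - 1) * y powr ((- p) * (\<nu> - 1)) = y powr \<mu>"
      by (simp only: powr_add[symmetric] ex)
    finally show ?thesis using e by simp
  qed
  have cf: "(\<lambda>w. c * f w) absolutely_integrable_on (g ` {0<..1}) \<and>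
       integral (g ` {0<..1}) (\<lambda>w. c * f w) = c * integral {\<tau>..} f"
    unfolding img using fint by (auto intro: set_integrable_mult_right)
  then have F: "F absolutely_integrable_on {0<..1} \<and> integral {0<..1} F = c * integral {\<tau>..} f"
    using has_absolute_integral_change_of_variables_1'[OF _ der inj, of "\<lambda>w. c * f w" "c * integral {\<tau>..} f"]
    unfolding F_def by simp
  have A: "(\<lambda>y. y powr \<mu> * flat_exp p y powr \<tau>) absolutely_integrable_on {0<..1}"
    using F key by (subst set_integrable_cong[OF refl refl, where f' = F]) auto
  have B: "integral {0<..1} (\<lambda>y. y powr \<mu> * flat_exp p y powr \<tau>) = c * integral {\<tau>..} f"
    using F key by (subst integral_cong[where g = F]) auto
  have A': "set_integrable lborel {0<..1} (\<lambda>y. y powr \<mu> * flat_exp p y powr \<tau>)"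
    using A unfolding set_integrable_def by (subst (asm) integrable_completion) auto
  have F': "set_integrable lborel {\<tau>..} f"
    using fint unfolding set_integrable_def f_def by (subst (asm) integrable_completion) auto
  have eqv: "(\<lambda>y::real. indicator {0..1} y *\<^sub>R (y powr \<mu> * flat_exp p y powr \<tau>))
     = (\<lambda>y. indicator {0<..1} y *\<^sub>R (y powr \<mu> * flat_exp p y powr \<tau>))"
    by (auto simp: fun_eq_iff indicator_def)
  have "(LINT y:{0<..1}|lborel. y powr \<mu> * flat_exp p y powr \<tau>) = c * (LINT w:{\<tau>..}|lborel. f w)"
    using set_borel_integral_eq_integral(2)[OF A'] set_borel_integral_eq_integral(2)[OF F'] B by simp
  with A' show ?thesis
    unfolding eqv \<nu>_def[symmetric] nu_eq
    by (simp add: has_bochner_integral_iff set_integrable_def set_lebesgue_integral_def c_def f_def)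
qed

text \<open>After the substitution the $y$-integral is $\tau^{-\delta+\kappa\tau/p}/p$ times an incomplete Gamma integral
with moving lower end and moving exponent. It converges to the complete Gamma integral by dominated convergence, and $\tau^{\kappa\tau/p}\to1$.
The linear drift \<open>\<kappa> * \<tau>\<close> of the exponent is there because $b\sigma$ depends on $\sigma$.\<close>
lemma flat_kernel_integral_tendsto:
  fixes p \<delta> \<kappa> :: real
  assumes p: "p > 0" and \<delta>: "\<delta> > 0" and \<kappa>: "\<kappa> \<ge> 0"
  shows "((\<lambda>\<tau>. \<tau> powr \<delta> * (\<integral>y. indicator {-1..1} y * (\<bar>y\<bar> powr (- 1 - p * \<delta> + \<kappa> * \<tau>) * flat_exp p y powr \<tau>) \<partial>lborel))
     \<longlongrightarrow> 2 * Gamma \<delta> / p) (at_right 0)"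
proof -
  define G where "G \<tau> = (\<integral>w. indicator {\<tau>..} w * (w powr (\<delta> - \<kappa> * \<tau> / p - 1) * exp (- w)) \<partial>lborel)" for \<tau> :: real
  \<comment> \<open>Below this threshold the drift of the Gamma exponent is at most half of \<open>\<delta>\<close>; the 1 covers \<open>\<kappa> = 0\<close>.\<close>
  define \<tau>0 where "\<tau>0 = p * \<delta> / (2 * (\<kappa> + 1))"
  have \<tau>0: "\<tau>0 > 0" using p \<delta> \<kappa> by (simp add: \<tau>0_def)
  have small: "\<kappa> * \<tau> / p \<le> \<delta> / 2" if "0 < \<tau>" "\<tau> < \<tau>0" for \<tau>
  proof -
    have "\<kappa> * \<tau> \<le> (\<kappa> + 1) * \<tau>0" using that \<kappa> by (intro mult_mono) auto
    also have "\<dots> = p * \<delta> / 2" using \<kappa> by (simp add: \<tau>0_def field_simps)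
    finally show ?thesis using p by (simp add: field_simps)
  qed
  have Gamma_int: "has_bochner_integral lborel (\<lambda>w. indicator {0..} w * (w powr (x - 1) * exp (- w))) (Gamma x)"
    if "x > 0" for x :: real
  proof -
    have hi: "((\<lambda>w. w powr (x - 1) * exp (- w)) has_integral Gamma x) {0..}"
      using Gamma_integral_real[OF that] by (simp add: exp_minus field_simps)
    then have "(\<lambda>w. w powr (x - 1) * exp (- w)) absolutely_integrable_on {0..}"
      by (intro nonnegative_absolutely_integrable_1) (auto simp: has_integral_integrable)
    then have int: "set_integrable lborel {0..} (\<lambda>w. w powr (x - 1) * exp (- w))"
      unfolding set_integrable_def by (subst (asm) integrable_completion) auto
    then show ?thesis
      using set_borel_integral_eq_integral(2)[OF int] hi
      by (simp add: has_bochner_integral_iff set_integrable_def set_lebesgue_integral_def integral_unique)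
  qed
  have G: "(G \<longlongrightarrow> Gamma \<delta>) (at_right 0)"
    unfolding tendsto_at_iff_sequentially
  proof (intro allI impI)
    fix X :: "nat \<Rightarrow> real" assume X: "\<forall>i. X i \<in> {0<..} - {0}" "X \<longlonglongrightarrow> 0"
    define Y where "Y n = (if X n < \<tau>0 then X n else \<tau>0 / 2)" for n
    have ev: "eventually (\<lambda>n. X n = Y n) sequentially"
      using order_tendstoD(2)[OF X(2) \<tau>0] by (auto simp: Y_def elim!: eventually_mono)
    have Y: "0 < Y n" "Y n < \<tau>0" for n using X(1) \<tau>0 by (auto simp: Y_def)
    have Ylim: "Y \<longlonglongrightarrow> 0" using X(2) ev by (rule Lim_transform_eventually)
    have "(\<lambda>n. G (Y n)) \<longlonglongrightarrow> (\<integral>w. indicator {0<..} w * (w powr (\<delta> - 1) * exp (- w)) \<partial>lborel)"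
      unfolding G_def
    proof (rule integral_dominated_convergence)
      show "integrable lborel (\<lambda>w::real. indicator {0..} w * (w powr (\<delta>/2 - 1) * exp (- w)) + indicator {0..} w * (w powr (\<delta> - 1) * exp (- w)))"
        using Gamma_int[of \<delta>] Gamma_int[of "\<delta>/2"] \<delta> by (auto simp: has_bochner_integral_iff)
      show "AE w in lborel. norm (indicator {Y n..} w * (w powr (\<delta> - \<kappa> * Y n / p - 1) * exp (- w)))
         \<le> indicator {0..} w * (w powr (\<delta>/2 - 1) * exp (- w)) + indicator {0..} w * (w powr (\<delta> - 1) * exp (- w))" for n
      proof (rule AE_I2)
        fix w :: real
        show "norm (indicator {Y n..} w * (w powr (\<delta> - \<kappa> * Y n / p - 1) * exp (- w)))
         \<le> indicator {0..} w * (w powr (\<delta>/2 - 1) * exp (- w)) + indicator {0..} w * (w powr (\<delta> - 1) * exp (- w))"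
        proof (cases "w \<ge> Y n")
          case True
          have "0 \<le> \<kappa> * Y n / p" using \<kappa> p Y[of n] by simp
          then have "w powr (\<delta> - \<kappa> * Y n / p - 1) \<le> w powr (\<delta>/2 - 1) + w powr (\<delta> - 1)"
            using True Y[of n] small[OF Y] 
              powr_mono'[of "\<delta>/2 - 1" "\<delta> - \<kappa> * Y n / p - 1" w] powr_mono[of "\<delta> - \<kappa> * Y n / p - 1" "\<delta> - 1" w]
            by (cases "w \<le> 1") (auto intro: add_increasing add_increasing2)
          then show ?thesis using True Y[of n]
            by (simp add: indicator_def distrib_right[symmetric])
        qed (auto simp: indicator_def)
      qed
      show "AE w in lborel. (\<lambda>n. indicator {Y n..} w * (w powr (\<delta> - \<kappa> * Y n / p - 1) * exp (- w)))
          \<longlonglongrightarrow> indicator {0<..} w * (w powr (\<delta> - 1) * exp (- w))"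
      proof (rule AE_I2)
        fix w :: real
        show "(\<lambda>n. indicator {Y n..} w * (w powr (\<delta> - \<kappa> * Y n / p - 1) * exp (- w)))
          \<longlonglongrightarrow> indicator {0<..} w * (w powr (\<delta> - 1) * exp (- w))"
        proof (cases "w > 0")
          case True
          have e: "eventually (\<lambda>n. w powr (\<delta> - \<kappa> * Y n / p - 1) * exp (- w) = indicator {Y n..} w * (w powr (\<delta> - \<kappa> * Y n / p - 1) * exp (- w))) sequentially"
            using order_tendstoD(2)[OF Ylim True] by eventually_elim auto
          have "(\<lambda>n. w powr (\<delta> - \<kappa> * Y n / p - 1) * exp (- w)) \<longlonglongrightarrow> w powr (\<delta> - \<kappa> * 0 / p - 1) * exp (- w)"
            using True p by (intro tendsto_intros Ylim) auto
          then have "(\<lambda>n. w powr (\<delta> - \<kappa> * Y n / p - 1) * exp (- w)) \<longlonglongrightarrow> indicator {0<..} w * (w powr (\<delta> - 1) * exp (- w))"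
            using True by simp
          then show ?thesis using e by (rule Lim_transform_eventually)
        next
          case False
          then have "indicator {Y n..} w = (0::real)" for n using Y(1)[of n] by (auto simp: indicator_def)
          with False show ?thesis by simp
        qed
      qed
    qed measurable
    also have "(\<integral>w. indicator {0<..} w * (w powr (\<delta> - 1) * exp (- w)) \<partial>lborel) = Gamma \<delta>"
      using Gamma_int[OF \<delta>] 
      by (auto simp: has_bochner_integral_iff indicator_def intro!: Bochner_Integration.integral_cong elim!: trans[rotated])
    finally have "(\<lambda>n. G (Y n)) \<longlonglongrightarrow> Gamma \<delta>" .
    then show "(G \<circ> X) \<longlonglongrightarrow> Gamma \<delta>"
      by (rule Lim_transform_eventually) (use ev in \<open>auto elim!: eventually_mono\<close>)
  qed
  have self: "((\<lambda>\<tau>::real. \<tau> powr (\<kappa> / p * \<tau>)) \<longlongrightarrow> 1) (at_right 0)"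
    by real_asymp
  have "((\<lambda>\<tau>. 2 * (\<tau> powr (\<kappa> / p * \<tau>) / p * G \<tau>)) \<longlongrightarrow> 2 * (1 / p * Gamma \<delta>)) (at_right 0)"
    using p by (intro tendsto_intros self G) auto
  moreover have "eventually (\<lambda>\<tau>. 2 * (\<tau> powr (\<kappa> / p * \<tau>) / p * G \<tau>) =
     \<tau> powr \<delta> * (\<integral>y. indicator {-1..1} y * (\<bar>y\<bar> powr (- 1 - p * \<delta> + \<kappa> * \<tau>) * flat_exp p y powr \<tau>) \<partial>lborel)) (at_right 0)"
    using eventually_at_right_less[of "0::real"] eventually_at_right_real[OF \<tau>0]
  proof eventually_elim
    case (elim \<tau>)
    define \<mu> where "\<mu> = - 1 - p * \<delta> + \<kappa> * \<tau>"
    have ex: "(\<mu> + 1) / p = - \<delta> + \<kappa> / p * \<tau>" "- (\<mu> + 1) / p = \<delta> - \<kappa> * \<tau> / p" 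
      using p by (auto simp: \<mu>_def field_simps)
    have pos: "- (\<mu> + 1) / p > 0" using small[of \<tau>] elim \<delta> unfolding ex by (simp only: greaterThanLessThan_iff) linarith
    note hb = flat_kernel_integral_half[OF p elim(1) pos]
    have eq: "(\<lambda>y. indicator {0..} y *\<^sub>R (indicator {-1..1} y * (\<bar>y\<bar> powr \<mu> * flat_exp p y powr \<tau>)))
       = (\<lambda>y. indicator {0..1} y *\<^sub>R (y powr \<mu> * flat_exp p y powr \<tau>))"
      by (auto simp: fun_eq_iff indicator_def)
    have "has_bochner_integral lborel (\<lambda>y. indicator {-1..1} y * (\<bar>y\<bar> powr \<mu> * flat_exp p y powr \<tau>))
      (2 *\<^sub>R (\<tau> powr ((\<mu> + 1) / p) / p * (\<integral>w. indicator {\<tau>..} w * (w powr (- (\<mu> + 1) / p - 1) * exp (- w)) \<partial>lborel)))"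
      by (rule has_bochner_integral_even_function, subst eq, rule hb) (auto simp: indicator_def flat_exp_def)
    then have "(\<integral>y. indicator {-1..1} y * (\<bar>y\<bar> powr \<mu> * flat_exp p y powr \<tau>) \<partial>lborel)
       = 2 * (\<tau> powr (- \<delta> + \<kappa> / p * \<tau>) / p * G \<tau>)"
      unfolding ex G_def by (simp add: has_bochner_integral_iff)
    moreover have "\<tau> powr \<delta> * \<tau> powr (- \<delta> + \<kappa> / p * \<tau>) = \<tau> powr (\<kappa> / p * \<tau>)"
      by (simp only: powr_add[symmetric]) simp
    ultimately show ?case unfolding \<mu>_def[symmetric] by (simp add: mult_ac)
  qed
  ultimately have "((\<lambda>\<tau>. \<tau> powr \<delta> * (\<integral>y. indicator {-1..1} y * (\<bar>y\<bar> powr (- 1 - p * \<delta> + \<kappa> * \<tau>) * flat_exp p y powr \<tau>) \<partial>lborel))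
     \<longlongrightarrow> 2 * (1 / p * Gamma \<delta>)) (at_right 0)"
    by (rule Lim_transform_eventually)
  then show ?thesis by (simp add: mult_ac)
qed

section \<open>Integrating the flat perturbation in x\<close>

text \<open>The transition happens at $|x| = E^{1/q}$. Inside, the bracket is $-1$ plus a term of size
$(E/x^q)^\sigma$; that term turns $|x|^{a\sigma}$ into $|x|^{(a-q)\sigma}$, which stays integrable up to $\sigma=-1/a$. Outside, the
bracket is at most $E/x^q$, and the decay in $x$ keeps the integral bounded. Only the $-1$ inside
therefore produces the factor $1/\epsilon$, multiplied by \<open>c\<close>. In the deviation of \<open>g\<close> from \<open>c\<close> the
term linear in $|x|$ makes the integral bounded, while the constant term \<open>d\<close> keeps the factor.
All contributions scale like $E^{\epsilon/q}$.\<close>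
lemma flat_perturbation_x_integral:
  fixes a q :: nat and \<sigma> E M L d c :: real and g :: "real \<Rightarrow> real"
  defines "\<epsilon> \<equiv> real a * \<sigma> + 1"
  assumes aq: "2 \<le> q" "q \<le> a" "even q" and \<sigma>: "- 1 / real a < \<sigma>" "\<sigma> < 0" and E: "0 < E" "E \<le> 1"
    and [measurable]: "g \<in> borel_measurable borel"
    and M: "\<And>x. \<bar>x\<bar> \<le> 1 \<Longrightarrow> \<bar>g x\<bar> \<le> M" and L: "\<And>x. \<bar>x\<bar> \<le> 1 \<Longrightarrow> \<bar>g x - c\<bar> \<le> L * \<bar>x\<bar> + d"
    and nn: "0 \<le> M" "0 \<le> L" "0 \<le> d"
  shows "\<bar>(\<integral>x. indicator {-1..1} x * (\<bar>x\<bar> powr (a * \<sigma>) * ((1 + E / x ^ q) powr \<sigma> - 1) * g x) \<partial>lborel)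
       + 2 * E powr (\<epsilon> / q) / \<epsilon> * c\<bar> \<le> (2 * (real a + 1) * M + 2 * L + 2 * d / \<epsilon>) * E powr (\<epsilon> / q)"
proof -
  have a0: "real a > 0" using aq by simp
  have \<epsilon>: "0 < \<epsilon>" "\<epsilon> < 1" using \<sigma> a0 by (auto simp: \<epsilon>_def field_simps mult_less_0_iff)
  have "- 1 / real a \<ge> -1" using aq by (simp add: field_simps)
  then have s1: "\<sigma> \<ge> -1" using \<sigma>(1) by linarith
  define r where "r = E powr (1 / q)"
  have r: "0 < r" "r \<le> 1" using E aq by (auto simp: r_def intro!: powr_le1)
  have rq: "r powr real q = E" using E aq by (simp add: r_def powr_powr)
  have r\<epsilon>: "E powr (\<epsilon> / q) = r powr \<epsilon>" by (simp add: r_def powr_powr)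
  define F where "F x = indicator {-1..1} x * (\<bar>x\<bar> powr (a * \<sigma>) * ((1 + E / x ^ q) powr \<sigma> - 1) * g x)" for x
  define P where "P x = indicator {-r..r} x * \<bar>x\<bar> powr (a * \<sigma>)" for x :: real
  define h1 where "h1 x = M * E powr \<sigma> * (indicator {-r..r} x * \<bar>x\<bar> powr ((a - q) * \<sigma>))" for x :: real
  define h2 where "h2 x = L * (indicator {-r..r} x * \<bar>x\<bar> powr (a * \<sigma> + 1))" for x :: real
  define h3 where "h3 x = M * E * ((indicator {-1..1} x - indicator {-r..r} x) * \<bar>x\<bar> powr (a * \<sigma> - q))" for x :: real
  \<comment> \<open>Inside the transition interval \<open>h1\<close> bounds the part of the bracket beyond $-1$, and \<open>h2\<close> with \<open>d * P\<close> the replacement of \<open>g\<close> by \<open>c\<close>;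
    \<open>h3\<close> bounds everything outside it.\<close>
  define h where "h x = h1 x + h2 x + d * P x + h3 x" for x
  have [simp]: "real (a - q) = real a - real q" using aq by simp
  have aqs: "(real a - real q) * \<sigma> + 1 \<ge> real q / real a"
  proof -
    have "(real a - real q) * (- 1 / real a) \<le> (real a - real q) * \<sigma>"
      using aq \<sigma> by (intro mult_left_mono) auto
    moreover have "(real a - real q) * (- 1 / real a) + 1 = real q / real a"
      using a0 by (simp add: field_simps)
    ultimately show ?thesis by linarith
  qed
  have aqs0: "real q / real a > 0" using aq a0 by simp
  have iP: "has_bochner_integral lborel P (2 * r powr \<epsilon> / \<epsilon>)"
    unfolding P_def \<epsilon>_def by (rule has_bochner_integral_abs_powr) (use \<epsilon> r in \<open>auto simp: \<epsilon>_def\<close>)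
  have ih1: "has_bochner_integral lborel h1 (M * E powr \<sigma> * (2 * r powr ((a - q) * \<sigma> + 1) / ((a - q) * \<sigma> + 1)))"
    unfolding h1_def by (intro has_bochner_integral_mult_right has_bochner_integral_abs_powr) (use aqs aqs0 r in auto)
  have ih2: "has_bochner_integral lborel h2 (L * (2 * r powr (a * \<sigma> + 1 + 1) / (a * \<sigma> + 1 + 1)))"
    unfolding h2_def by (intro has_bochner_integral_mult_right has_bochner_integral_abs_powr) (use \<epsilon> r in \<open>auto simp: \<epsilon>_def\<close>)
  have ih3: "has_bochner_integral lborel h3 (M * E * (2 * (r powr (a * \<sigma> - q + 1) - 1) / (- (a * \<sigma> - q) - 1)))"
    unfolding h3_def by (intro has_bochner_integral_mult_right has_bochner_integral_abs_powr_outside) (use \<epsilon> r aq in \<open>auto simp: \<epsilon>_def\<close>)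
  have ih: "has_bochner_integral lborel h (M * E powr \<sigma> * (2 * r powr ((a - q) * \<sigma> + 1) / ((a - q) * \<sigma> + 1))
     + L * (2 * r powr (a * \<sigma> + 1 + 1) / (a * \<sigma> + 1 + 1)) + d * (2 * r powr \<epsilon> / \<epsilon>)
     + M * E * (2 * (r powr (a * \<sigma> - q + 1) - 1) / (- (a * \<sigma> - q) - 1)))" (is "has_bochner_integral _ _ ?H")
    unfolding h_def using iP ih1 ih2 ih3 by (intro has_bochner_integral_add has_bochner_integral_mult_right)
  have H1: "M * E powr \<sigma> * (2 * r powr ((a - q) * \<sigma> + 1) / ((a - q) * \<sigma> + 1)) \<le> 2 * a * M * r powr \<epsilon>"
  proof -
    have "E powr \<sigma> * r powr ((a - q) * \<sigma> + 1) = r powr (q * \<sigma> + ((a - q) * \<sigma> + 1))"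
      using rq by (metis powr_add powr_powr)
    also have "q * \<sigma> + ((a - q) * \<sigma> + 1) = \<epsilon>" by (simp add: \<epsilon>_def algebra_simps)
    finally have e: "E powr \<sigma> * r powr ((a - q) * \<sigma> + 1) = r powr \<epsilon>" .
    have "1 / ((a - q) * \<sigma> + 1) \<le> 1 / (real q / real a)" using aqs aqs0 by (intro divide_left_mono mult_pos_pos) (simp_all, linarith?)
    also have "\<dots> \<le> a" using aq a0 by (simp add: field_simps)
    finally have "2 * M * r powr \<epsilon> * (1 / ((a - q) * \<sigma> + 1)) \<le> 2 * M * r powr \<epsilon> * a"
      using nn by (intro mult_left_mono) auto
    then show ?thesis unfolding e[symmetric] by (simp add: mult_ac)
  qed
  have H2: "L * (2 * r powr (a * \<sigma> + 1 + 1) / (a * \<sigma> + 1 + 1)) \<le> 2 * L * r powr \<epsilon>"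
  proof -
    have "r powr (\<epsilon> + 1) \<le> r powr \<epsilon>" using r by (intro powr_mono') auto
    then have "r powr (\<epsilon> + 1) / (\<epsilon> + 1) \<le> r powr \<epsilon> / 1" using \<epsilon> by (intro frac_le) auto
    then have "2 * L * (r powr (\<epsilon> + 1) / (\<epsilon> + 1)) \<le> 2 * L * r powr \<epsilon>"
      using nn by (intro mult_left_mono) auto
    then show ?thesis by (simp add: \<epsilon>_def mult_ac)
  qed
  have H3: "M * E * (2 * (r powr (a * \<sigma> - q + 1) - 1) / (- (a * \<sigma> - q) - 1)) \<le> 2 * M * r powr \<epsilon>"
  proof -
    have e: "E * r powr (\<epsilon> - q) = r powr \<epsilon>"
      unfolding rq[symmetric] by (simp add: powr_add[symmetric])
    have "E * (r powr (\<epsilon> - q) - 1) \<le> r powr \<epsilon>" using e E by (simp add: algebra_simps)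
    then have "E * (r powr (\<epsilon> - q) - 1) / (q - \<epsilon>) \<le> r powr \<epsilon> / 1"
      using \<epsilon> aq by (intro frac_le) auto
    then have le: "2 * M * (E * (r powr (\<epsilon> - q) - 1) / (q - \<epsilon>)) \<le> 2 * M * r powr \<epsilon>"
      using nn by (intro mult_left_mono) auto
    have ex: "a * \<sigma> - q + 1 = \<epsilon> - q" "- (a * \<sigma> - q) - 1 = q - \<epsilon>" by (auto simp: \<epsilon>_def)
    show ?thesis unfolding ex using le by (simp add: mult_ac)
  qed
  have H: "?H \<le> (2 * (real a + 1) * M + 2 * L + 2 * d / \<epsilon>) * E powr (\<epsilon> / q)"
    unfolding r\<epsilon> using H1 H2 H3 by (simp add: algebra_simps)
  have bound: "\<bar>F x + c * P x\<bar> \<le> h x" for x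
  proof (cases "x = 0 \<or> x \<notin> {-1..1}")
    case True
    then have "F x = 0" "P x = 0" using r by (auto simp: F_def P_def indicator_def)
    moreover have "h x = 0" using True r by (auto simp: h_def h1_def h2_def h3_def P_def indicator_def)
    ultimately show ?thesis by simp
  next
    case False
    then have x: "x \<noteq> 0" "\<bar>x\<bar> \<le> 1" by auto
    have xq: "x ^ q = \<bar>x\<bar> powr q" using x aq by (simp add: powr_realpow power_even_abs)
    have xq0: "\<bar>x\<bar> powr q > 0" using x by simp
    define w where "w = E / x ^ q"
    have w: "w > 0" using E x xq xq0 by (simp add: w_def)
    have Fx: "F x = \<bar>x\<bar> powr (a * \<sigma>) * ((1 + w) powr \<sigma> - 1) * g x"
      using False by (auto simp: F_def w_def)
    show ?thesis
    proof (cases "\<bar>x\<bar> \<le> r")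
      case True
      then have i: "indicator {-r..r} x = (1::real)" "indicator {-1..1} x = (1::real)" using r by (auto simp: indicator_def)
      have "(1 + w) powr \<sigma> \<le> w powr \<sigma>" using w \<sigma> by (intro powr_mono2') auto
      also have "w powr \<sigma> = E powr \<sigma> * \<bar>x\<bar> powr (- (q * \<sigma>))"
        unfolding w_def xq using E x by (simp add: powr_divide powr_powr powr_minus divide_simps)
      finally have "\<bar>x\<bar> powr (a * \<sigma>) * (1 + w) powr \<sigma> \<le> \<bar>x\<bar> powr (a * \<sigma>) * (E powr \<sigma> * \<bar>x\<bar> powr (- (q * \<sigma>)))"
        by (intro mult_left_mono) auto
      also have "\<dots> = E powr \<sigma> * \<bar>x\<bar> powr ((a - q) * \<sigma>)"
        by (simp add: powr_add[symmetric] algebra_simps)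
      finally have b1: "\<bar>x\<bar> powr (a * \<sigma>) * (1 + w) powr \<sigma> \<le> E powr \<sigma> * \<bar>x\<bar> powr ((a - q) * \<sigma>)" .
      have "F x + c * P x = \<bar>x\<bar> powr (a * \<sigma>) * (1 + w) powr \<sigma> * g x - \<bar>x\<bar> powr (a * \<sigma>) * (g x - c)"
        by (simp add: Fx P_def i algebra_simps)
      then have "\<bar>F x + c * P x\<bar> \<le> \<bar>\<bar>x\<bar> powr (a * \<sigma>) * (1 + w) powr \<sigma> * g x\<bar> + \<bar>\<bar>x\<bar> powr (a * \<sigma>) * (g x - c)\<bar>"
        by linarith
      also have "\<dots> \<le> E powr \<sigma> * \<bar>x\<bar> powr ((a - q) * \<sigma>) * M + \<bar>x\<bar> powr (a * \<sigma>) * (L * \<bar>x\<bar> + d)"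
        using mult_mono[OF b1 M[OF x(2)]] mult_left_mono[OF L[OF x(2)], of "\<bar>x\<bar> powr (a * \<sigma>)"]
        by (intro add_mono) (auto simp: abs_mult)
      also have "\<dots> = h x" using x
        by (simp add: h_def h1_def h2_def h3_def P_def i powr_add algebra_simps)
      finally show ?thesis .
    next
      case far: False
      then have i: "indicator {-r..r} x = (0::real)" "indicator {-1..1} x = (1::real)" using x by (auto simp: indicator_def)
      have "1 - w \<le> 1 / (1 + w)" using w by (simp add: field_simps)
      also have "\<dots> = (1 + w) powr (-1)" using w by (simp add: powr_minus divide_simps)
      also have "\<dots> \<le> (1 + w) powr \<sigma>" using w s1 by (intro powr_mono) auto
      finally have "1 - (1 + w) powr \<sigma> \<le> w" by simp
      moreover have "(1 + w) powr \<sigma> \<le> (1 + w) powr 0" using w \<sigma> by (intro powr_mono) auto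
      ultimately have b: "\<bar>(1 + w) powr \<sigma> - 1\<bar> \<le> w" using w by simp
      have "\<bar>F x + c * P x\<bar> \<le> \<bar>x\<bar> powr (a * \<sigma>) * w * M"
        unfolding Fx P_def i using b M[OF x(2)] w by (auto simp: abs_mult intro!: mult_mono)
      also have "\<dots> = h x" using x
        by (simp add: h_def h1_def h2_def h3_def P_def i w_def xq powr_diff)
      finally show ?thesis .
    qed
  qed
  have [measurable]: "F \<in> borel_measurable borel" "P \<in> borel_measurable borel"
    unfolding F_def P_def by measurable
  have intFP: "integrable lborel (\<lambda>x. F x + c * P x)"
  proof (rule Bochner_Integration.integrable_bound)
    show "integrable lborel h" using ih by (simp add: has_bochner_integral_iff)
    show "AE x in lborel. norm (F x + c * P x) \<le> norm (h x)"
      using bound by (intro AE_I2) (metis abs_ge_self order_trans real_norm_def)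
  qed measurable
  have intP: "integrable lborel (\<lambda>x. c * P x)" using iP by (auto simp: has_bochner_integral_iff)
  have intF: "integrable lborel F" using Bochner_Integration.integrable_diff[OF intFP intP] by simp
  have "integral\<^sup>L lborel F + 2 * E powr (\<epsilon> / q) / \<epsilon> * c = (\<integral>x. F x + c * P x \<partial>lborel)"
    using intF intP iP by (simp add: has_bochner_integral_iff r\<epsilon>)
  also have "\<bar>\<dots>\<bar> \<le> integral\<^sup>L lborel h"
    using norm_integral_le_integral[OF intFP, of h] ih bound by (auto simp: has_bochner_integral_iff)
  also have "\<dots> = ?H" using ih by (simp add: has_bochner_integral_iff)
  also note H
  finally show ?thesis unfolding F_def .
qed

section \<open>The local zeta function of a flat perturbation\<close>

text \<open>With $u=\ln(1+t)$ the left side is $|e^{su}-1|$, at most $|s|u$ times the maximal modulus of the exponential on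
the segment, and the logarithm $u$ is bounded by any small power of $t$ up to a constant.\<close>
lemma norm_of_real_powr_minus_1_le:
  fixes t \<eta> :: real and s :: complex
  assumes "0 \<le> t" "0 < \<eta>" "\<eta> \<le> 1"
  shows "norm (complex_of_real \<bar>1 + t\<bar> powr s - 1) \<le> 2 * norm s / \<eta> * t powr \<eta> * (1 + t) powr max 0 (Re s)"
proof (cases "t = 0")
  case False
  then have t: "t > 0" using assms by simp
  define u where "u = ln (1 + t)"
  have u: "u \<ge> 0" using t by (simp add: u_def)
  have ue: "1 + t = exp u" using t by (simp add: u_def)
  have e: "complex_of_real \<bar>1 + t\<bar> powr s = exp (s * of_real u)"
    using t by (simp add: powr_def Ln_of_real u_def del: of_real_add)
  let ?S = "{w. Re w \<le> max 0 (Re (s * of_real u))}"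
  have "norm (exp (s * of_real u) - exp 0) \<le> exp (max 0 (Re (s * of_real u))) * norm (s * of_real u - 0)"
  proof (rule field_differentiable_bound[where S = ?S and f' = exp])
    show "convex ?S" using convex_halfspace_le[of "1::complex"] by (simp add: inner_complex_def)
  qed (auto intro!: derivative_eq_intros)
  also have "exp (max 0 (Re (s * of_real u))) = (1 + t) powr max 0 (Re s)"
    using u unfolding ue by (simp add: powr_def max_def mult_le_0_iff zero_le_mult_iff)
  also have "norm (s * of_real u - 0) = norm s * u" using u by (simp add: norm_mult)
  finally have 1: "norm (complex_of_real \<bar>1 + t\<bar> powr s - 1) \<le> (1 + t) powr max 0 (Re s) * (norm s * u)"
    using e by simp
  have "u \<le> 2 * t powr \<eta> / \<eta>"
  proof (cases "t \<le> 1")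
    case True
    have "u \<le> t" unfolding u_def using t by (intro ln_add_one_self_le_self) auto
    also have "t \<le> t powr \<eta>" using t True assms powr_mono'[of \<eta> 1 t] by simp
    also have "t powr \<eta> = t powr \<eta> * 1" by simp
    also have "\<dots> \<le> t powr \<eta> * (2 / \<eta>)" using assms by (intro mult_left_mono) auto
    finally show ?thesis by (simp add: mult.commute)
  next
    case False
    have "1 + \<eta> * u \<le> exp (\<eta> * u)" by (rule exp_ge_add_one_self)
    also have "\<dots> = (1 + t) powr \<eta>" unfolding ue by (simp add: powr_def)
    also have "\<dots> \<le> (2 * t) powr \<eta>" using False assms by (intro powr_mono2) auto
    also have "\<dots> = 2 powr \<eta> * t powr \<eta>" using t by (simp add: powr_mult)
    also have "\<dots> \<le> 2 powr 1 * t powr \<eta>" using assms by (intro mult_right_mono powr_mono) auto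
    finally show ?thesis using assms by (simp add: field_simps)
  qed
  then have "(1 + t) powr max 0 (Re s) * (norm s * u) \<le> (1 + t) powr max 0 (Re s) * (norm s * (2 * t powr \<eta> / \<eta>))"
    by (intro mult_left_mono) auto
  with 1 show ?thesis by (simp add: mult_ac)
qed (use assms in auto)

lemma borel_measurable_fst_real [measurable]: "fst \<in> borel_measurable (borel :: (real \<times> real) measure)"
  by (intro borel_measurable_continuous_onI continuous_intros)

lemma borel_measurable_snd_real [measurable]: "snd \<in> borel_measurable (borel :: (real \<times> real) measure)"
  by (intro borel_measurable_continuous_onI continuous_intros)

lemma has_bochner_integral_lborel_product:
  fixes f g :: "real \<Rightarrow> 'b::{real_normed_field, banach, second_countable_topology}"
  assumes f: "has_bochner_integral lborel f I" and g: "has_bochner_integral lborel g J"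
  shows "has_bochner_integral lborel (\<lambda>z. f (fst z) * g (snd z)) (I * J)"
proof -
  have [measurable]: "f \<in> borel_measurable borel" "g \<in> borel_measurable borel"
    using f g by (auto simp: has_bochner_integral_iff)
  have fi: "integrable lborel f" "integral\<^sup>L lborel f = I" and gi: "integrable lborel g" "integral\<^sup>L lborel g = J"
    using f g by (auto simp: has_bochner_integral_iff)
  have int: "integrable (lborel \<Otimes>\<^sub>M lborel) (\<lambda>z. f (fst z) * g (snd z))"
    by (rule lborel_pair.Fubini_integrable) (use fi gi in \<open>auto simp: norm_mult\<close>)
  have "(\<integral>z. f (fst z) * g (snd z) \<partial>(lborel \<Otimes>\<^sub>M lborel)) = (\<integral>x. \<integral>y. f x * g y \<partial>lborel \<partial>lborel)"
    using lborel_pair.integral_fst'[OF int] by simp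
  also have "\<dots> = I * J" using fi gi by simp
  finally show ?thesis using int by (simp add: has_bochner_integral_iff lborel_prod)
qed

lemma of_real_abs_power_powr:
  assumes "n > 0"
  shows "complex_of_real (\<bar>u\<bar> ^ n) powr s = complex_of_real \<bar>u\<bar> powr (of_nat n * s)"
proof (cases "u = 0")
  case False
  then have "ln (\<bar>u\<bar> ^ n) = real n * ln \<bar>u\<bar>" by (simp add: ln_realpow)
  with False show ?thesis
    by (simp add: powr_def Ln_of_real of_real_power[symmetric] mult_ac del: of_real_power)
qed (use assms in simp)

lemma of_real_mult_powr:
  "0 \<le> u \<Longrightarrow> 0 \<le> v \<Longrightarrow> complex_of_real (u * v) powr s = of_real u powr s * of_real v powr s"
  by (simp add: powr_times_real)

text \<open>Confining the support to the square $[-1,1]^2$ replaces the condition on a small neighbourhood: every power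
integral below is then taken over $[-1,1]$, where $|x|^c$ decreases in $c$.\<close>
locale flat_perturbation =
  fixes a b q :: nat and p :: real and \<phi> :: "real \<times> real \<Rightarrow> real"
  assumes a2: "2 \<le> a" and ab: "a \<le> b" and p0: "p > 0" and evenq: "even q" and q2: "2 \<le> q" and qa: "q \<le> a"
    and smooth: "smooth \<phi>" and supp: "\<And>x y. \<phi> (x, y) \<noteq> 0 \<Longrightarrow> \<bar>x\<bar> \<le> 1 \<and> \<bar>y\<bar> \<le> 1"
begin

definition half_plane :: "complex set" where "half_plane = {s. Re s > - 1 / real a}"

definition \<psi> :: "nat \<Rightarrow> real \<Rightarrow> real" where
  "\<psi> k x = (dir_deriv (0, 1) ^^ k) \<phi> (x, 0)"

text \<open>The order \<open>b\<close> makes $|y|^{b\sigma}$ times the remainder bounded on the whole half-plane, since $b\sigma+b\ge0$ there.\<close>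
definition taylor_rem :: "real \<Rightarrow> real \<Rightarrow> real" where
  "taylor_rem x y = \<phi> (x, y) - (\<Sum>k<b. \<psi> k x / fact k * y ^ k)"

definition flat_ratio :: "real \<Rightarrow> real \<Rightarrow> real" where
  "flat_ratio x y = flat_exp p y / x ^ q"

definition moment :: "nat \<Rightarrow> complex \<Rightarrow> complex" where
  "moment k s = (\<integral>x. indicator {-1..1} x *\<^sub>R (of_real \<bar>x\<bar> powr (of_nat a * s) * of_real (\<psi> k x)) \<partial>lborel)"

definition remainder_part :: "complex \<Rightarrow> complex" where
  "remainder_part s = (\<integral>z. indicator {-1..1} (fst z) *\<^sub>R indicator {-1..1} (snd z) *\<^sub>R
     (of_real \<bar>fst z\<bar> powr (of_nat a * s) * of_real \<bar>snd z\<bar> powr (of_nat b * s) * of_real (taylor_rem (fst z) (snd z))) \<partial>lborel)"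

definition flat_integrand :: "complex \<Rightarrow> real \<times> real \<Rightarrow> complex" where
  "flat_integrand s z = of_real \<bar>fst z\<bar> powr (of_nat a * s) * of_real \<bar>snd z\<bar> powr (of_nat b * s)
     * (of_real \<bar>1 + flat_ratio (fst z) (snd z)\<bar> powr s - 1) * of_real (\<phi> z)"

definition flat_part :: "complex \<Rightarrow> complex" where
  "flat_part s = (\<integral>z. flat_integrand s z \<partial>lborel)"

definition taylor_term :: "nat \<Rightarrow> complex \<Rightarrow> complex" where
  "taylor_term k s = (1 + (-1) ^ k) / (fact k * (of_nat b * s + of_nat k + 1)) * moment k s"

definition continuation :: "complex \<Rightarrow> complex" where
  "continuation s = flat_part s + remainder_part s + (\<Sum>k<b. taylor_term k s)"

lemma a0: "real a > 0" and b0: "real b > 0" and q0: "real q > 0" using a2 ab q2 by auto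

lemma supp_outside:
  assumes "x \<notin> {-1..1} \<or> y \<notin> {-1..1}"
  shows "\<phi> (x, y) = 0"
proof (rule ccontr)
  assume "\<phi> (x, y) \<noteq> 0"
  with supp[of x y] assms show False by auto
qed

lemma bounded_phi: obtains M where "M \<ge> 0" "\<And>z. \<bar>\<phi> z\<bar> \<le> M"
proof -
  have "compact ({-1..1} \<times> {-1..1} :: (real \<times> real) set)" by (intro compact_Times) auto
  from smooth_bounded_on_compact[OF smooth this] obtain M where M: "M \<ge> 0" "\<And>z. z \<in> {-1..1} \<times> {-1..1} \<Longrightarrow> \<bar>\<phi> z\<bar> \<le> M"
    by blast
  have "\<bar>\<phi> z\<bar> \<le> M" for z
  proof (cases "\<phi> z = 0")
    case False
    then have "z \<in> {-1..1} \<times> {-1..1}"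
      using supp[of "fst z" "snd z"] by (auto simp: mem_Times_iff)
    then show ?thesis by (rule M(2))
  qed (use M(1) in simp)
  with M(1) show thesis by (rule that)
qed

lemma bounded_psi: obtains B where "B \<ge> 0" "\<And>x. x \<in> {-1..1} \<Longrightarrow> \<bar>\<psi> k x\<bar> \<le> B"
proof -
  have "compact ({-1..1} \<times> {0} :: (real \<times> real) set)" by (intro compact_Times) auto
  from smooth_bounded_on_compact[OF smooth_iter_dir_deriv[OF smooth, where v = "(0,1)" and n = k] this]
  obtain B where "B \<ge> 0" "\<And>z. z \<in> {-1..1} \<times> {0} \<Longrightarrow> \<bar>(dir_deriv (0,1) ^^ k) \<phi> z\<bar> \<le> B" by blast
  then show thesis by (intro that[of B]) (auto simp: \<psi>_def)
qed

lemma measurable_phi [measurable]: "\<phi> \<in> borel_measurable borel"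
  by (rule smooth_imp_borel_measurable[OF smooth])

lemma continuous_psi: "continuous_on UNIV (\<psi> k)"
  unfolding \<psi>_def
  by (intro continuous_on_compose2[OF smooth_imp_continuous_on[OF smooth_iter_dir_deriv[OF smooth], of UNIV]])
     (auto intro!: continuous_intros)

lemma measurable_psi [measurable]: "\<psi> k \<in> borel_measurable borel"
  by (intro borel_measurable_continuous_onI continuous_psi)

lemma measurable_taylor_rem [measurable]: "(\<lambda>z. taylor_rem (fst z) (snd z)) \<in> borel_measurable borel"
  unfolding taylor_rem_def prod.collapse by measurable

lemma measurable_flat_ratio [measurable]: "(\<lambda>z. flat_ratio (fst z) (snd z)) \<in> borel_measurable borel"
  unfolding flat_ratio_def by measurable

lemma measurable_flat_integrand [measurable]: "flat_integrand s \<in> borel_measurable borel"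
  unfolding flat_integrand_def by measurable

lemma bounded_taylor_rem: obtains B where "B \<ge> 0" "\<And>x y. x \<in> {-1..1} \<Longrightarrow> y \<in> {-1..1} \<Longrightarrow> \<bar>taylor_rem x y\<bar> \<le> B * \<bar>y\<bar> ^ b"
proof -
  have "compact ({-1..1} \<times> {-1..1} :: (real \<times> real) set)" by (intro compact_Times) auto
  from smooth_bounded_on_compact[OF smooth_iter_dir_deriv[OF smooth, where v = "(0,1)" and n = b] this]
  obtain B where B: "B \<ge> 0" "\<And>z. z \<in> {-1..1} \<times> {-1..1} \<Longrightarrow> \<bar>(dir_deriv (0,1) ^^ b) \<phi> z\<bar> \<le> B" by blast
  have "\<bar>taylor_rem x y\<bar> \<le> B * \<bar>y\<bar> ^ b" if xy: "x \<in> {-1..1}" "y \<in> {-1..1}" for x y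
  proof -
    from smooth_Taylor_along_line[OF smooth, of y "(x, 0)" "(0, 1)" b]
    obtain t where t: "\<bar>t\<bar> \<le> \<bar>y\<bar>" "\<phi> (x, y) = (\<Sum>k<b. \<psi> k x / fact k * y ^ k) + (dir_deriv (0, 1) ^^ b) \<phi> (x, t) / fact b * y ^ b"
      by (auto simp: \<psi>_def)
    have t_in: "t \<in> {-1..1}"
      using t(1) xy(2) by (auto simp: abs_if split: if_splits)
    from t have "\<bar>taylor_rem x y\<bar> = \<bar>(dir_deriv (0, 1) ^^ b) \<phi> (x, t)\<bar> / fact b * \<bar>y\<bar> ^ b"
      by (simp add: taylor_rem_def abs_mult power_abs)
    also have "\<dots> \<le> B / 1 * \<bar>y\<bar> ^ b"
      using B(1) B(2)[of "(x, t)"] xy t_in by (intro mult_right_mono frac_le) auto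
    finally show ?thesis by simp
  qed
  with B(1) show thesis by (rule that)
qed

text \<open>Local domination needs a lower bound on the real part that is still to the right of $-1/a$. Taking it negative makes
$|x|^{a\sigma_0}\ge1$ on the square, which covers large real parts as well.\<close>
lemma in_half_plane_nhd:
  assumes "s \<in> half_plane"
  obtains r \<sigma>0 where "r > 0" "- 1 / real a < \<sigma>0" "\<sigma>0 < 0"
    "\<And>z. z \<in> ball s r \<Longrightarrow> Re z \<ge> \<sigma>0 \<and> norm z \<le> norm s + 1"
proof
  define r where "r = min 1 ((Re s + 1 / real a) / 2)"
  show "r > 0" using assms a0 by (auto simp: r_def half_plane_def)
  show "- 1 / real a < min ((Re s - 1 / real a) / 2) (- 1 / (2 * real a))" "min ((Re s - 1 / real a) / 2) (- 1 / (2 * real a)) < 0"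
    using assms a0 by (auto simp: half_plane_def field_simps min_less_iff_disj)
  fix z assume "z \<in> ball s r"
  then have d: "norm (s - z) < r" by (simp add: dist_norm)
  have "Re s - Re z \<le> norm (s - z)" using complex_Re_le_cmod[of "s - z"] by simp
  moreover have "norm z \<le> norm s + norm (s - z)" using norm_triangle_ineq4[of s "s - z"] by simp
  ultimately show "Re z \<ge> min ((Re s - 1 / real a) / 2) (- 1 / (2 * real a)) \<and> norm z \<le> norm s + 1"
    using d by (auto simp: r_def field_simps min_le_iff_disj)
qed

lemma open_half_plane: "open half_plane"
  unfolding half_plane_def by (rule open_halfspace_Re_gt)

lemma moment_holomorphic: "moment k holomorphic_on half_plane"
  unfolding moment_def
proof (rule holomorphic_on_integral_dominated[OF open_half_plane])
  obtain B where B: "B \<ge> 0" "\<And>x. x \<in> {-1..1} \<Longrightarrow> \<bar>\<psi> k x\<bar> \<le> B" using bounded_psi by blast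
  fix s assume "s \<in> half_plane"
  then obtain r \<sigma>0 where r: "r > 0" "- 1 / real a < \<sigma>0" "\<sigma>0 < 0"
    "\<And>z. z \<in> ball s r \<Longrightarrow> Re z \<ge> \<sigma>0 \<and> norm z \<le> norm s + 1" by (rule in_half_plane_nhd) blast
  have "integrable lborel (\<lambda>x. B * (indicator {-1..1} x * \<bar>x\<bar> powr (real a * \<sigma>0)))"
    using has_bochner_integral_abs_powr[of "real a * \<sigma>0" 1] r(2) a0 by (auto simp: has_bochner_integral_iff field_simps)
  moreover have "norm (indicator {-1..1} x *\<^sub>R (of_real \<bar>x\<bar> powr (of_nat a * z) * complex_of_real (\<psi> k x)))
     \<le> B * (indicator {-1..1} x * \<bar>x\<bar> powr (real a * \<sigma>0))" if z: "z \<in> ball s r" for z x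
  proof (cases "x \<in> {-1..1}")
    case True
    have "\<bar>x\<bar> powr (real a * Re z) \<le> \<bar>x\<bar> powr (real a * \<sigma>0)"
      using r(4)[OF z] True a0 by (intro powr_mono') auto
    then show ?thesis using True B(2)[OF True] B(1)
      by (simp add: norm_mult norm_of_real_abs_powr mult.commute[of B] mult_mono)
  qed simp
  ultimately show "\<exists>r>0. \<exists>g. integrable lborel g \<and> (\<forall>z\<in>ball s r. \<forall>x. norm (indicator {-1..1} x *\<^sub>R (of_real \<bar>x\<bar> powr (of_nat a * z) * complex_of_real (\<psi> k x))) \<le> g x)"
    using r(1) by blast
qed (auto intro!: holomorphic_intros simp: scaleR_conv_of_real)

lemma powr_b_bound: "\<bar>y\<bar> powr (real b * \<sigma>) * \<bar>y\<bar> ^ b \<le> 1" if "\<sigma> \<ge> - 1 / real a" "y \<in> {-1..1}"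
proof (cases "y = 0")
  case False
  have "\<bar>y\<bar> powr (real b * \<sigma>) * \<bar>y\<bar> ^ b = \<bar>y\<bar> powr (real b * (\<sigma> + 1))"
    using False by (simp add: powr_add powr_realpow distrib_left)
  also have "\<dots> \<le> 1"
  proof (rule powr_le1)
    have "- 1 / real a \<ge> -1" using a2 by (simp add: field_simps)
    then show "0 \<le> real b * (\<sigma> + 1)" using that(1) by simp
  qed (use that in auto)
  finally show ?thesis .
qed simp

lemma remainder_part_integrand_bound:
  assumes B: "B \<ge> 0" "\<And>x y. x \<in> {-1..1} \<Longrightarrow> y \<in> {-1..1} \<Longrightarrow> \<bar>taylor_rem x y\<bar> \<le> B * \<bar>y\<bar> ^ b"
    and s: "- 1 / real a \<le> \<sigma>0" "\<sigma>0 \<le> Re s"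
  shows "norm (indicator {-1..1} (fst z) *\<^sub>R indicator {-1..1} (snd z) *\<^sub>R
     (of_real \<bar>fst z\<bar> powr (of_nat a * s) * of_real \<bar>snd z\<bar> powr (of_nat b * s) * complex_of_real (taylor_rem (fst z) (snd z))))
     \<le> B * ((indicator {-1..1} (fst z) * \<bar>fst z\<bar> powr (real a * \<sigma>0)) * indicator {-1..1} (snd z))"
proof (cases "fst z \<in> {-1..1} \<and> snd z \<in> {-1..1}")
  case True
  have "\<bar>snd z\<bar> powr (real b * Re s) * \<bar>taylor_rem (fst z) (snd z)\<bar> \<le> \<bar>snd z\<bar> powr (real b * Re s) * (B * \<bar>snd z\<bar> ^ b)"
    using B(2)[of "fst z" "snd z"] True by (intro mult_left_mono) auto
  also have "\<dots> = B * (\<bar>snd z\<bar> powr (real b * Re s) * \<bar>snd z\<bar> ^ b)" by simp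
  also have "\<dots> \<le> B * 1" using B(1) powr_b_bound[of "Re s" "snd z"] s True by (intro mult_left_mono) auto
  finally have 1: "\<bar>snd z\<bar> powr (real b * Re s) * \<bar>taylor_rem (fst z) (snd z)\<bar> \<le> B" by simp
  have "\<bar>fst z\<bar> powr (real a * Re s) \<le> \<bar>fst z\<bar> powr (real a * \<sigma>0)"
    using s(2) True a0 by (intro powr_mono') auto
  from mult_mono[OF this 1] show ?thesis using True B(1)
    by (simp add: norm_mult norm_of_real_abs_powr mult_ac)
qed auto

lemma integrable_x_powr_square:
  assumes "- 1 / real a < \<sigma>0"
  shows "has_bochner_integral lborel (\<lambda>z::real\<times>real. (indicator {-1..1} (fst z) * \<bar>fst z\<bar> powr (real a * \<sigma>0)) * indicator {-1..1} (snd z))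
     (2 / (real a * \<sigma>0 + 1) * 2)"
proof (rule has_bochner_integral_lborel_product[where f = "\<lambda>x. indicator {-1..1} x * \<bar>x\<bar> powr (real a * \<sigma>0)" and g = "indicator {-1..1}"])
  show "has_bochner_integral lborel (\<lambda>x. indicator {-1..1} x * \<bar>x\<bar> powr (real a * \<sigma>0)) (2 / (real a * \<sigma>0 + 1))"
    using has_bochner_integral_abs_powr[of "real a * \<sigma>0" 1] assms a0 by (simp add: field_simps)
  show "has_bochner_integral lborel (indicator {-1..1::real}) (2::real)"
    using has_bochner_integral_real_indicator[of "{-1..1::real}" lborel] by simp
qed

lemma remainder_part_holomorphic: "remainder_part holomorphic_on half_plane"
  unfolding remainder_part_def
proof (rule holomorphic_on_integral_dominated[OF open_half_plane])
  obtain B where B: "B \<ge> 0" "\<And>x y. x \<in> {-1..1} \<Longrightarrow> y \<in> {-1..1} \<Longrightarrow> \<bar>taylor_rem x y\<bar> \<le> B * \<bar>y\<bar> ^ b" using bounded_taylor_rem by blast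
  fix s assume "s \<in> half_plane"
  then obtain r \<sigma>0 where r: "r > 0" "- 1 / real a < \<sigma>0" "\<sigma>0 < 0"
    "\<And>z. z \<in> ball s r \<Longrightarrow> Re z \<ge> \<sigma>0 \<and> norm z \<le> norm s + 1" by (rule in_half_plane_nhd) blast
  have "integrable lborel (\<lambda>z::real\<times>real. B * ((indicator {-1..1} (fst z) * \<bar>fst z\<bar> powr (real a * \<sigma>0)) * indicator {-1..1} (snd z) :: real))"
    using integrable_x_powr_square[OF r(2)] by (auto simp: has_bochner_integral_iff)
  then show "\<exists>r>0. \<exists>g. integrable lborel g \<and> (\<forall>s\<in>ball s r. \<forall>z. norm (indicator {-1..1} (fst z) *\<^sub>R indicator {-1..1} (snd z) *\<^sub>R
     (of_real \<bar>fst z\<bar> powr (of_nat a * s) * of_real \<bar>snd z\<bar> powr (of_nat b * s) * complex_of_real (taylor_rem (fst z) (snd z)))) \<le> g z)"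
    by (rule_tac exI[of _ r], intro conjI r(1) exI, assumption, intro ballI allI remainder_part_integrand_bound[OF B])
       (use r(2,4) in auto)
qed (auto intro!: holomorphic_intros simp: scaleR_conv_of_real)

lemma flat_ratio_nonneg: "flat_ratio x y \<ge> 0"
  using flat_exp_bounds(1)[of p y] evenq by (simp add: flat_ratio_def zero_le_even_power)

text \<open>For $\sigma>0$ the singular denominator in $(1+r)^\sigma$ is cancelled by $|x|^{q\sigma}$, leaving $(x^q+e(y))^\sigma\le2^\sigma$.\<close>
lemma x_factor_bound:
  assumes x: "x \<in> {-1..1}" "x \<noteq> 0" and s: "\<sigma>0 \<le> \<sigma>" "\<sigma>0 \<le> 0"
  shows "\<bar>x\<bar> powr (real a * \<sigma>) * (1 + flat_ratio x y) powr max 0 \<sigma> \<le> 2 powr max 0 \<sigma> * \<bar>x\<bar> powr (real a * \<sigma>0)"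
proof (cases "\<sigma> \<le> 0")
  case True
  then show ?thesis using x s flat_ratio_nonneg[of x y] a0 by (auto simp: max_absorb1 intro!: powr_mono')
next
  case False
  have xq: "x ^ q = \<bar>x\<bar> powr real q" using x evenq by (simp add: powr_realpow power_even_abs)
  have xq1: "x ^ q \<le> 1" using x evenq by (metis abs_le_iff atLeastAtMost_iff power_even_abs power_le_one abs_ge_zero minus_le_iff)
  have xq0: "x ^ q > 0" using x evenq by (simp add: zero_less_power_eq)
  have "\<bar>x\<bar> powr (real a * \<sigma>) = \<bar>x\<bar> powr ((real a - real q) * \<sigma>) * (x ^ q) powr \<sigma>"
    unfolding xq using x qa by (simp add: powr_powr powr_add[symmetric] of_nat_diff algebra_simps)
  then have "\<bar>x\<bar> powr (real a * \<sigma>) * (1 + flat_ratio x y) powr \<sigma> = \<bar>x\<bar> powr ((real a - real q) * \<sigma>) * ((x ^ q) * (1 + flat_ratio x y)) powr \<sigma>"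
    using xq0 flat_ratio_nonneg[of x y] by (simp add: powr_mult)
  also have "(x ^ q) * (1 + flat_ratio x y) = x ^ q + flat_exp p y" using xq0 x by (simp add: flat_ratio_def field_simps)
  also have "\<bar>x\<bar> powr ((real a - real q) * \<sigma>) * (x ^ q + flat_exp p y) powr \<sigma> \<le> 1 * 2 powr \<sigma>"
    using x False xq1 xq0 qa flat_exp_bounds[of p y] by (intro mult_mono powr_le1 powr_mono2) auto
  also have "1 * 2 powr \<sigma> \<le> 2 powr \<sigma> * \<bar>x\<bar> powr (real a * \<sigma>0)"
  proof -
    have "\<bar>x\<bar> powr 0 \<le> \<bar>x\<bar> powr (real a * \<sigma>0)" using x s a0 by (intro powr_mono') (auto simp: mult_nonneg_nonpos)
    then show ?thesis using x by simp
  qed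
  finally show ?thesis using False by (simp add: max_def)
qed

text \<open>One integrable function dominates the flat integrand on a whole bounded piece of the half-plane. The exponent
\<open>\<eta>\<close> is small enough for $|x|^{a\sigma_0-q\eta}$ to be integrable, and the positive power $e(y)^\eta$ then cancels $|y|^{b\sigma_0}$ completely.\<close>
lemma flat_integrand_dominated:
  assumes \<sigma>0: "- 1 / real a < \<sigma>0" "\<sigma>0 < 0"
  obtains g where "integrable lborel g"
    "\<And>s z. Re s \<ge> \<sigma>0 \<Longrightarrow> norm s \<le> B \<Longrightarrow> norm (flat_integrand s z) \<le> g z"
proof -
  obtain M where M: "M \<ge> 0" "\<And>z. \<bar>\<phi> z\<bar> \<le> M" using bounded_phi by blast
  define \<eta> where "\<eta> = min 1 ((real a * \<sigma>0 + 1) / (2 * real q))"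
  have e0: "real a * \<sigma>0 + 1 > 0" using \<sigma>0 a0 by (simp add: field_simps)
  have \<eta>: "0 < \<eta>" "\<eta> \<le> 1" using e0 q0 by (auto simp: \<eta>_def)
  have "real q * \<eta> \<le> real q * ((real a * \<sigma>0 + 1) / (2 * real q))" using q0 by (intro mult_left_mono) (auto simp: \<eta>_def)
  then have ex: "real a * \<sigma>0 - real q * \<eta> > -1" using q0 e0 by simp
  \<comment> \<open>This choice gives $|y|^{p\theta}=|y|^{-b\sigma_0}$, the exact inverse of the singular factor in $y$.\<close>
  define \<theta> where "\<theta> = - real b * \<sigma>0 / p"
  have \<theta>: "\<theta> > 0" using \<sigma>0 b0 p0 by (simp add: \<theta>_def divide_neg_pos mult_pos_neg)
  define C where "C = \<theta> powr \<theta> * \<eta> powr (- \<theta>)"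
  define K where "K = 2 powr \<bar>B\<bar> * C * (2 * \<bar>B\<bar> / \<eta>) * M"
  let ?g = "\<lambda>z::real\<times>real. K * ((indicator {-1..1} (fst z) * \<bar>fst z\<bar> powr (real a * \<sigma>0 - real q * \<eta>)) * indicator {-1..1} (snd z))"
  have hx: "has_bochner_integral lborel (\<lambda>x. indicator {-1..1} x * \<bar>x\<bar> powr (real a * \<sigma>0 - real q * \<eta>)) (2 / (real a * \<sigma>0 - real q * \<eta> + 1))"
    using has_bochner_integral_abs_powr[OF ex, of 1] by simp
  have hy: "has_bochner_integral lborel (indicator {-1..1::real}) (2::real)"
    using has_bochner_integral_real_indicator[of "{-1..1::real}" lborel] by simp
  have "integrable lborel ?g"
    using has_bochner_integral_lborel_product[OF hx hy] by (auto simp: has_bochner_integral_iff)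
  moreover have "norm (flat_integrand s z) \<le> ?g z" if s: "Re s \<ge> \<sigma>0" "norm s \<le> B" for s z
  proof -
    obtain x y where z: "z = (x, y)" by force
    have K0: "K \<ge> 0" using M \<eta> by (simp add: K_def C_def)
    show ?thesis
    proof (cases "x \<in> {-1..1} - {0} \<and> y \<in> {-1..1} - {0}")
      case False
      then have "flat_integrand s z = 0"
        using supp_outside[of x y] by (auto simp: flat_integrand_def z)
      then show ?thesis using K0 by simp
    next
      case True
      have xq: "x ^ q = \<bar>x\<bar> powr real q" using True evenq by (simp add: powr_realpow power_even_abs)
      have B0: "B \<ge> 0" using s(2) norm_ge_zero order_trans by blast
      have "flat_ratio x y powr \<eta> = flat_exp p y powr \<eta> * \<bar>x\<bar> powr (- (real q * \<eta>))"
        unfolding flat_ratio_def xq using True flat_exp_bounds[of p y] by (simp add: powr_divide powr_powr powr_minus divide_simps)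
      then have 1: "norm (of_real \<bar>1 + flat_ratio x y\<bar> powr s - 1) \<le>
         2 * norm s / \<eta> * (flat_exp p y powr \<eta> * \<bar>x\<bar> powr (- (real q * \<eta>))) * (1 + flat_ratio x y) powr max 0 (Re s)"
        using norm_of_real_powr_minus_1_le[OF flat_ratio_nonneg[of x y] \<eta>, of s] by simp
      have "\<bar>y\<bar> powr (real b * Re s) \<le> \<bar>y\<bar> powr (real b * \<sigma>0)"
        using True s b0 by (intro powr_mono') auto
      then have "\<bar>y\<bar> powr (real b * Re s) * flat_exp p y powr \<eta> \<le> \<bar>y\<bar> powr (real b * \<sigma>0) * (C * \<bar>y\<bar> powr (p * \<theta>))"
        using flat_exp_powr_le[OF \<eta>(1) \<theta>, of p y] by (intro mult_mono) (auto simp: C_def)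
      also have "\<dots> = C * \<bar>y\<bar> powr (real b * \<sigma>0 + p * \<theta>)" by (simp add: powr_add)
      also have "real b * \<sigma>0 + p * \<theta> = 0" using p0 by (simp add: \<theta>_def)
      finally have 2: "\<bar>y\<bar> powr (real b * Re s) * flat_exp p y powr \<eta> \<le> C" using True by simp
      have "2 powr max 0 (Re s) \<le> 2 powr \<bar>B\<bar>"
        using s(2) complex_Re_le_cmod[of s] B0 by (intro powr_mono) auto
      then have 3: "\<bar>x\<bar> powr (real a * Re s) * (1 + flat_ratio x y) powr max 0 (Re s) \<le> 2 powr \<bar>B\<bar> * \<bar>x\<bar> powr (real a * \<sigma>0)"
        using True s \<sigma>0 
        by (intro order_trans[OF x_factor_bound[of x \<sigma>0 "Re s" y]] mult_right_mono) auto
      have "norm (flat_integrand s z) \<le> \<bar>x\<bar> powr (real a * Re s) * \<bar>y\<bar> powr (real b * Re s) *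
         (2 * norm s / \<eta> * (flat_exp p y powr \<eta> * \<bar>x\<bar> powr (- (real q * \<eta>))) * (1 + flat_ratio x y) powr max 0 (Re s)) * M"
        unfolding flat_integrand_def z norm_mult using 1 M(2)[of "(x, y)"] M(1) \<eta>(1) by (intro mult_mono) (auto simp: norm_of_real_abs_powr)
      also have "\<dots> = (\<bar>x\<bar> powr (real a * Re s) * (1 + flat_ratio x y) powr max 0 (Re s)) * (\<bar>y\<bar> powr (real b * Re s) * flat_exp p y powr \<eta>)
         * (2 * norm s / \<eta>) * M * \<bar>x\<bar> powr (- (real q * \<eta>))"
        by (simp add: mult_ac)
      also have "\<dots> \<le> (2 powr \<bar>B\<bar> * \<bar>x\<bar> powr (real a * \<sigma>0)) * C * (2 * \<bar>B\<bar> / \<eta>) * M * \<bar>x\<bar> powr (- (real q * \<eta>))"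
      proof -
        have mono: "A * A' * u * M * v \<le> B1 * B1' * u' * M * v"
          if "A \<le> B1" "A' \<le> B1'" "u \<le> u'" "0 \<le> A" "0 \<le> A'" "0 \<le> u" "0 \<le> v" for A A' u v B1 B1' u' :: real
          using that M(1) by (intro mult_mono mult_nonneg_nonneg) auto
        show ?thesis
          using s(2) \<eta> B0 by (intro mono 2 3 divide_right_mono) auto
      qed
      also have "\<dots> = K * \<bar>x\<bar> powr (real a * \<sigma>0 - real q * \<eta>)"
        by (simp add: K_def powr_diff powr_minus divide_simps)
      also have "\<dots> = ?g z" using True by (simp add: z)
      finally show ?thesis .
    qed
  qed
  ultimately show thesis by (rule that)
qed

lemma flat_part_holomorphic: "flat_part holomorphic_on half_plane"
  unfolding flat_part_def
proof (rule holomorphic_on_integral_dominated[OF open_half_plane])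
  fix s assume "s \<in> half_plane"
  then obtain r \<sigma>0 where r: "r > 0" "- 1 / real a < \<sigma>0" "\<sigma>0 < 0"
    "\<And>z. z \<in> ball s r \<Longrightarrow> Re z \<ge> \<sigma>0 \<and> norm z \<le> norm s + 1" by (rule in_half_plane_nhd) blast
  obtain g where "integrable lborel g"
    "\<And>t z. Re t \<ge> \<sigma>0 \<Longrightarrow> norm t \<le> norm s + 1 \<Longrightarrow> norm (flat_integrand t z) \<le> g z"
    using flat_integrand_dominated[OF r(2,3)] by blast
  then show "\<exists>r>0. \<exists>g. integrable lborel g \<and> (\<forall>t\<in>ball s r. \<forall>z. norm (flat_integrand t z) \<le> g z)"
    using r(1,4) by blast
qed (auto intro!: holomorphic_intros simp: flat_integrand_def)

lemma flat_part_integrable: "s \<in> half_plane \<Longrightarrow> integrable lborel (flat_integrand s)"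
proof -
  assume "s \<in> half_plane"
  then obtain r \<sigma>0 where r: "r > 0" "- 1 / real a < \<sigma>0" "\<sigma>0 < 0"
    "\<And>z. z \<in> ball s r \<Longrightarrow> Re z \<ge> \<sigma>0 \<and> norm z \<le> norm s + 1" by (rule in_half_plane_nhd) blast
  obtain g where g: "integrable lborel g"
    "\<And>t z. Re t \<ge> \<sigma>0 \<Longrightarrow> norm t \<le> norm s + 1 \<Longrightarrow> norm (flat_integrand t z) \<le> g z"
    using flat_integrand_dominated[OF r(2,3)] by blast
  have "norm (flat_integrand s z) \<le> g z" for z using g(2)[of s z] r(1) r(4)[of s] by auto
  then show ?thesis
    by (intro Bochner_Integration.integrable_bound[OF g(1)]) (auto intro!: AE_I2 intro: order_trans[OF _ abs_ge_self])
qed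

section \<open>Splitting the zeta integral\<close>

lemma phase_powr_eq:
  assumes "x \<noteq> 0"
  shows "complex_of_real \<bar>phase a b q p (x, y)\<bar> powr s
    = of_real \<bar>x\<bar> powr (of_nat a * s) * of_real \<bar>y\<bar> powr (of_nat b * s) * of_real \<bar>1 + flat_ratio x y\<bar> powr s"
proof -
  have "x ^ a = x ^ (a - q) * x ^ q" using qa by (simp add: power_add[symmetric])
  then have "x ^ a * flat_ratio x y = x ^ (a - q) * flat_exp p y"
    using assms by (simp add: flat_ratio_def)
  then have "phase a b q p (x, y) = x ^ a * y ^ b * (1 + flat_ratio x y)"
    by (simp add: phase_def distrib_left mult_ac)
  then have "\<bar>phase a b q p (x, y)\<bar> = \<bar>x\<bar> ^ a * \<bar>y\<bar> ^ b * \<bar>1 + flat_ratio x y\<bar>"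
    by (simp add: abs_mult power_abs)
  then have "complex_of_real \<bar>phase a b q p (x, y)\<bar> powr s
     = complex_of_real (\<bar>x\<bar> ^ a) powr s * complex_of_real (\<bar>y\<bar> ^ b) powr s * of_real \<bar>1 + flat_ratio x y\<bar> powr s"
    by (simp add: of_real_mult_powr del: of_real_mult of_real_power)
  then show ?thesis using a0 b0 by (simp only: of_real_abs_power_powr of_nat_0_less_iff)
qed

lemma Re_pos_in_half_plane:
  assumes "Re s > 0"
  shows "s \<in> half_plane"
proof -
  have "- 1 / real a < 0" using a0 by simp
  with assms show ?thesis unfolding half_plane_def by (simp only: mem_Collect_eq)
qed

lemma moment_integrable:
  assumes "s \<in> half_plane"
  shows "has_bochner_integral lborel (\<lambda>x. indicator {-1..1} x *\<^sub>R (of_real \<bar>x\<bar> powr (of_nat a * s) * of_real (\<psi> k x))) (moment k s)"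
proof -
  obtain B where B: "B \<ge> 0" "\<And>x. x \<in> {-1..1} \<Longrightarrow> \<bar>\<psi> k x\<bar> \<le> B" using bounded_psi by blast
  have "Re s > - 1 / real a" using assms by (simp add: half_plane_def)
  then have "integrable lborel (\<lambda>x. B * (indicator {-1..1} x * \<bar>x\<bar> powr (real a * Re s)))"
    using has_bochner_integral_abs_powr[of "real a * Re s" 1] a0 by (auto simp: has_bochner_integral_iff field_simps)
  then have "integrable lborel (\<lambda>x. indicator {-1..1} x *\<^sub>R (of_real \<bar>x\<bar> powr (of_nat a * s) * complex_of_real (\<psi> k x)))"
  proof (rule Bochner_Integration.integrable_bound)
    show "AE x in lborel. norm (indicator {-1..1} x *\<^sub>R (of_real \<bar>x\<bar> powr (of_nat a * s) * complex_of_real (\<psi> k x)))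
       \<le> norm (B * (indicator {-1..1} x * \<bar>x\<bar> powr (real a * Re s)))"
      using B by (intro AE_I2) (auto simp: norm_mult norm_of_real_abs_powr indicator_def mult.commute[of B] intro!: mult_left_mono)
  qed measurable
  then show ?thesis by (simp add: has_bochner_integral_iff moment_def)
qed

lemma remainder_part_integrable:
  assumes "s \<in> half_plane"
  shows "has_bochner_integral lborel (\<lambda>z. indicator {-1..1} (fst z) *\<^sub>R indicator {-1..1} (snd z) *\<^sub>R
     (of_real \<bar>fst z\<bar> powr (of_nat a * s) * of_real \<bar>snd z\<bar> powr (of_nat b * s) * of_real (taylor_rem (fst z) (snd z)))) (remainder_part s)"
   (is "has_bochner_integral _ ?f _")
proof -
  obtain B where B: "B \<ge> 0" "\<And>x y. x \<in> {-1..1} \<Longrightarrow> y \<in> {-1..1} \<Longrightarrow> \<bar>taylor_rem x y\<bar> \<le> B * \<bar>y\<bar> ^ b" using bounded_taylor_rem by blast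
  have s: "- 1 / real a < Re s" using assms by (simp add: half_plane_def)
  have "integrable lborel (\<lambda>z::real\<times>real. B * ((indicator {-1..1} (fst z) * \<bar>fst z\<bar> powr (real a * Re s)) * indicator {-1..1} (snd z) :: real))"
    using integrable_x_powr_square[OF s] by (auto simp: has_bochner_integral_iff)
  then have "integrable lborel ?f"
  proof (rule Bochner_Integration.integrable_bound)
    show "AE z in lborel. norm (?f z) \<le> norm (B * ((indicator {-1..1} (fst z) * \<bar>fst z\<bar> powr (real a * Re s)) * indicator {-1..1} (snd z)))"
    proof (rule AE_I2)
      fix z
      have "norm (?f z) \<le> B * ((indicator {-1..1} (fst z) * \<bar>fst z\<bar> powr (real a * Re s)) * indicator {-1..1} (snd z))"
        by (rule remainder_part_integrand_bound[OF B]) (use s in auto)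
      also have "\<dots> \<le> norm \<dots>" unfolding real_norm_def by (rule abs_ge_self)
      finally show "norm (?f z) \<le> norm (B * ((indicator {-1..1} (fst z) * \<bar>fst z\<bar> powr (real a * Re s)) * indicator {-1..1} (snd z)))" .
    qed
  qed measurable
  then show ?thesis by (simp add: has_bochner_integral_iff remainder_part_def)
qed

lemma taylor_term_integral:
  assumes "Re s > 0"
  shows "has_bochner_integral lborel (\<lambda>z. indicator {-1..1} (fst z) *\<^sub>R indicator {-1..1} (snd z) *\<^sub>R
     (of_real \<bar>fst z\<bar> powr (of_nat a * s) * of_real \<bar>snd z\<bar> powr (of_nat b * s) * of_real (\<psi> k (fst z) / fact k * snd z ^ k))) (taylor_term k s)"
proof -
  have "Re (of_nat b * s) + real k > -1" using assms by (simp add: add_strict_increasing2 less_le_trans[of "-1" 0])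
  then have y: "has_bochner_integral lborel (\<lambda>y. indicator {-1..1::real} y *\<^sub>R (of_real \<bar>y\<bar> powr (of_nat b * s) * of_real (y ^ k)))
     ((1 + (-1) ^ k) / (of_nat b * s + of_nat k + 1))"
    by (rule has_bochner_integral_of_real_powr_monomial)
  have "s \<in> half_plane" using assms by (rule Re_pos_in_half_plane)
  have "has_bochner_integral lborel (\<lambda>z. 1 / fact k * ((indicator {-1..1} (fst z) *\<^sub>R (of_real \<bar>fst z\<bar> powr (of_nat a * s) * of_real (\<psi> k (fst z))))
      * (indicator {-1..1} (snd z) *\<^sub>R (of_real \<bar>snd z\<bar> powr (of_nat b * s) * of_real (snd z ^ k)))))
     (1 / fact k * (moment k s * ((1 + (-1) ^ k) / (of_nat b * s + of_nat k + 1))))"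
    by (intro has_bochner_integral_mult_right) (rule has_bochner_integral_lborel_product[OF moment_integrable[OF \<open>s \<in> half_plane\<close>] y])
  then
  show ?thesis by (simp add: taylor_term_def scaleR_conv_of_real mult_ac)
qed

text \<open>In the region of convergence all pieces are absolutely integrable, so the decomposition of the integrand can be
integrated term by term. The factorisation of the phase fails only on the null line $x=0$.\<close>
lemma local_zeta_eq:
  assumes "Re s > 0"
  shows "local_zeta (phase a b q p) \<phi> s = continuation s"
proof -
  have half_plane: "s \<in> half_plane" using assms by (rule Re_pos_in_half_plane)
  let ?P = "\<lambda>z. complex_of_real \<bar>fst z\<bar> powr (of_nat a * s) * of_real \<bar>snd z\<bar> powr (of_nat b * s)"
  let ?kernel_integral = "\<lambda>z. indicator {-1..1} (fst z) *\<^sub>R indicator {-1..1} (snd z) *\<^sub>R (?P z * of_real (taylor_rem (fst z) (snd z)))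
      + (\<Sum>k<b. indicator {-1..1} (fst z) *\<^sub>R indicator {-1..1} (snd z) *\<^sub>R (?P z * of_real (\<psi> k (fst z) / fact k * snd z ^ k)))"
  have kernel_integral: "?kernel_integral z = ?P z * of_real (\<phi> z)" for z
  proof (cases "fst z \<in> {-1..1} \<and> snd z \<in> {-1..1}")
    case True
    then have "?kernel_integral z = ?P z * of_real (taylor_rem (fst z) (snd z)) + (\<Sum>k<b. ?P z * of_real (\<psi> k (fst z) / fact k * snd z ^ k))"
      by simp
    also have "\<dots> = ?P z * of_real (taylor_rem (fst z) (snd z) + (\<Sum>k<b. \<psi> k (fst z) / fact k * snd z ^ k))"
      by (simp only: sum_distrib_left[symmetric] distrib_left[symmetric] of_real_add of_real_sum)
    also have "taylor_rem (fst z) (snd z) + (\<Sum>k<b. \<psi> k (fst z) / fact k * snd z ^ k) = \<phi> z"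
      by (simp add: taylor_rem_def)
    finally show ?thesis .
  next
    case False
    then show ?thesis using supp_outside[of "fst z" "snd z"] by auto
  qed
  have hb: "has_bochner_integral lborel (\<lambda>z. flat_integrand s z + ?kernel_integral z) (flat_part s + (remainder_part s + (\<Sum>k<b. taylor_term k s)))"
  proof (intro has_bochner_integral_add has_bochner_integral_sum)
    show "has_bochner_integral lborel (flat_integrand s) (flat_part s)"
      using flat_part_integrable[OF half_plane] by (simp add: has_bochner_integral_iff flat_part_def)
  qed (rule remainder_part_integrable[OF half_plane] taylor_term_integral[OF assms])+
  have "AE z in lborel. complex_of_real \<bar>phase a b q p z\<bar> powr s * of_real (\<phi> z) = flat_integrand s z + ?kernel_integral z"
    using AE_lborel_inner_neq[of "(1::real, 0::real)" 0]
  proof (rule AE_mp)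
    show "(1::real, 0::real) \<in> Basis" by (simp add: Basis_prod_def)
    show "AE z in lborel. z \<bullet> (1, 0) \<noteq> 0 \<longrightarrow> complex_of_real \<bar>phase a b q p z\<bar> powr s * of_real (\<phi> z) = flat_integrand s z + ?kernel_integral z"
    proof (intro AE_I2 impI)
      fix z :: "real \<times> real" assume "z \<bullet> (1, 0) \<noteq> 0"
      then have "fst z \<noteq> 0" by (simp add: inner_prod_def)
      from phase_powr_eq[OF this, of "snd z" s]
      have 1: "complex_of_real \<bar>phase a b q p z\<bar> powr s = ?P z * of_real \<bar>1 + flat_ratio (fst z) (snd z)\<bar> powr s" by simp
      show "complex_of_real \<bar>phase a b q p z\<bar> powr s * of_real (\<phi> z) = flat_integrand s z + ?kernel_integral z"
        unfolding kernel_integral 1 flat_integrand_def by (simp add: algebra_simps)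
    qed
  qed
  moreover have "(\<lambda>z. phase a b q p z) \<in> borel_measurable borel"
  proof -
    have "(\<lambda>z. phase a b q p z) = (\<lambda>z. fst z ^ a * snd z ^ b + fst z ^ (a - q) * snd z ^ b * flat_exp p (snd z))"
      by (simp add: phase_def fun_eq_iff split_beta)
    then show ?thesis by simp
  qed
  ultimately have "local_zeta (phase a b q p) \<phi> s = (\<integral>z. flat_integrand s z + ?kernel_integral z \<partial>lborel)"
    unfolding local_zeta_def by (intro integral_cong_AE) (auto simp: kernel_integral)
  also have "\<dots> = continuation s" using hb by (simp add: has_bochner_integral_iff continuation_def add.assoc)
  finally show ?thesis .
qed

definition regular_points :: "complex set" where
  "regular_points = {s \<in> half_plane. \<forall>k<b. of_nat b * s + of_nat k + 1 \<noteq> 0}"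

lemma open_regular_points: "open regular_points"
proof -
  have "regular_points = half_plane \<inter> (\<Inter>k\<in>{..<b}. {s. of_nat b * s + of_nat k + 1 \<noteq> 0})"
    by (auto simp: regular_points_def)
  also have "open \<dots>"
    by (intro open_Int open_half_plane open_INT finite_lessThan ballI open_Collect_neq continuous_intros)
  finally show ?thesis .
qed

lemma continuation_analytic: "continuation analytic_on regular_points"
proof -
  have "continuation holomorphic_on regular_points"
    unfolding continuation_def taylor_term_def
    by (intro holomorphic_intros holomorphic_on_subset[OF flat_part_holomorphic] holomorphic_on_subset[OF remainder_part_holomorphic]
          holomorphic_on_subset[OF moment_holomorphic]) (auto simp: regular_points_def)
  then show ?thesis using open_regular_points by (simp add: analytic_on_open)
qed

lemma continuation_meromorphic: "continuation meromorphic_on half_plane"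
  unfolding continuation_def taylor_term_def
  by (intro meromorphic_intros analytic_on_imp_meromorphic_on analytic_on_open[THEN iffD2]
       open_half_plane flat_part_holomorphic remainder_part_holomorphic moment_holomorphic) 

lemma Re_pos_in_regular_points: "Re s > 0 \<Longrightarrow> s \<in> regular_points"
proof -
  assume s: "Re s > 0"
  have "s \<in> half_plane" using s by (rule Re_pos_in_half_plane)
  moreover have "of_nat b * s + of_nat k + 1 \<noteq> 0" for k
  proof
    assume "of_nat b * s + of_nat k + 1 = 0"
    then have "Re (of_nat b * s + of_nat k + 1) = 0" by simp
    then have "real b * Re s + real k + 1 = 0" by simp
    moreover have "real b * Re s > 0" using s b0 by simp
    ultimately show False by linarith
  qed
  ultimately show ?thesis by (simp add: regular_points_def)
qed

lemma local_zeta_holomorphic: "local_zeta (phase a b q p) \<phi> holomorphic_on {s. Re s > 0}"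
proof (rule holomorphic_transform)
  show "continuation holomorphic_on {s. Re s > 0}"
    using analytic_imp_holomorphic[OF continuation_analytic] by (rule holomorphic_on_subset) (auto intro: Re_pos_in_regular_points)
qed (use local_zeta_eq in auto)

text \<open>A zero of a denominator is some $-(k+1)/b$, and lying to the right of $-1/a$ means exactly $k+1<b/a$.\<close>
lemma half_plane_minus_regular_points: 
  assumes "s \<in> half_plane" "s \<notin> regular_points"
  shows "\<exists>j::nat. s = complex_of_real (- real j / real b) \<and> 1 \<le> j \<and> real j < real b / real a"
proof -
  from assms obtain k where k: "of_nat b * s + of_nat k + 1 = 0" by (auto simp: regular_points_def)
  have b0': "of_nat b \<noteq> (0::complex)" using b0 by simp
  have s: "s = complex_of_real (- real (Suc k) / real b)"
    using k b0' by (simp add: field_simps eq_neg_iff_add_eq_0)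
  have "- 1 / real a < - real (Suc k) / real b" using assms(1) unfolding s half_plane_def by simp
  then have "real (Suc k) < real b / real a" using a0 b0 by (simp add: field_simps)
  with s show ?thesis by (intro exI[of _ "Suc k"]) auto
qed

section \<open>Approaching the abscissa\<close>

definition \<epsilon> :: "real \<Rightarrow> real" where "\<epsilon> \<sigma> = real a * \<sigma> + 1"

abbreviation at_abscissa :: "real filter" where "at_abscissa \<equiv> at_right (- 1 / real a)"

lemma eps_pos: "\<sigma> > - 1 / real a \<Longrightarrow> \<epsilon> \<sigma> > 0"
  using a0 by (simp add: \<epsilon>_def field_simps)

lemma eventually_at_abscissa: "eventually (\<lambda>\<sigma>. - 1 / real a < \<sigma> \<and> \<sigma> < 0) at_abscissa"
  using eventually_at_right_real[of "- 1 / real a" 0] a0 by simp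

lemma eps_tendsto: "filterlim \<epsilon> (at_right 0) at_abscissa"
proof -
  have "(\<epsilon> \<longlongrightarrow> real a * (- 1 / real a) + 1) at_abscissa"
    unfolding \<epsilon>_def by (intro tendsto_intros)
  then have "(\<epsilon> \<longlongrightarrow> 0) at_abscissa" using a0 by simp
  moreover have "eventually (\<lambda>\<sigma>. \<epsilon> \<sigma> \<in> {0<..} \<and> \<epsilon> \<sigma> \<noteq> 0) at_abscissa"
    using eventually_at_abscissa by eventually_elim (use eps_pos in force)
  ultimately show ?thesis by (simp add: filterlim_at eventually_conj_iff)
qed

lemma eps_powr_tendsto_0:
  assumes "\<alpha> > 0"
  shows "((\<lambda>\<sigma>. \<epsilon> \<sigma> powr \<alpha>) \<longlongrightarrow> 0) at_abscissa"
proof -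
  have "((\<lambda>t::real. t powr \<alpha>) \<longlongrightarrow> 0) (at_right 0)"
    using assms by real_asymp
  from filterlim_compose[OF this eps_tendsto] show ?thesis .
qed

text \<open>Replacing \<open>\<psi> k x\<close> by \<open>\<psi> k 0\<close> costs $O(|x|)$, which makes the integral bounded at the abscissa, and
the constant integrates to $2/\epsilon$.\<close>
lemma moment_tendsto: "((\<lambda>\<sigma>. of_real (\<epsilon> \<sigma>) * moment k (of_real \<sigma>)) \<longlongrightarrow> of_real (2 * \<psi> k 0)) at_abscissa"
proof -
  obtain L where L: "L \<ge> 0" "\<And>x y. x \<in> {-1..1} \<Longrightarrow> y \<in> {-1..1} \<Longrightarrow>
      \<bar>(dir_deriv (0,1) ^^ k) \<phi> (x, y) - (dir_deriv (0,1) ^^ k) \<phi> (0, 0)\<bar> \<le> L * \<bar>x\<bar> + L * \<bar>y\<bar>"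
    using smooth_difference_bound[OF smooth_iter_dir_deriv[OF smooth, of k "(0,1)"]] by blast
  have Lx: "\<bar>\<psi> k x - \<psi> k 0\<bar> \<le> L * \<bar>x\<bar>" if "x \<in> {-1..1}" for x
    using L(2)[OF that, of 0] by (simp add: \<psi>_def)
  have "eventually (\<lambda>\<sigma>. norm (of_real (\<epsilon> \<sigma>) * moment k (of_real \<sigma>) - of_real (2 * \<psi> k 0)) \<le> 2 * L * \<epsilon> \<sigma> powr 1) at_abscissa"
    using eventually_at_abscissa
  proof eventually_elim
    case (elim \<sigma>)
    then have e: "\<epsilon> \<sigma> > 0" using eps_pos by simp
    have \<sigma>half_plane: "complex_of_real \<sigma> \<in> half_plane" using elim by (simp add: half_plane_def)
    let ?f = "\<lambda>x. indicator {-1..1} x *\<^sub>R (complex_of_real \<bar>x\<bar> powr (of_nat a * of_real \<sigma>) * of_real (\<psi> k x))"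
    let ?g = "\<lambda>x::real. indicator {-1..1} x * \<bar>x\<bar> powr (real a * \<sigma>)"
    have pw: "complex_of_real \<bar>x\<bar> powr (of_nat a * of_real \<sigma>) = of_real (\<bar>x\<bar> powr (real a * \<sigma>))" for x
      using powr_of_real[of "\<bar>x\<bar>" "real a * \<sigma>"] by simp
    have hg: "has_bochner_integral lborel ?g (2 / \<epsilon> \<sigma>)"
      using has_bochner_integral_abs_powr[of "real a * \<sigma>" 1] e by (simp add: \<epsilon>_def)
    have hL: "has_bochner_integral lborel (\<lambda>x::real. L * (indicator {-1..1} x * \<bar>x\<bar> powr (real a * \<sigma> + 1))) (L * (2 / (\<epsilon> \<sigma> + 1)))"
      using has_bochner_integral_abs_powr[of "real a * \<sigma> + 1" 1] e
      by (intro has_bochner_integral_mult_right) (simp add: \<epsilon>_def)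
    have "has_bochner_integral lborel (\<lambda>x. ?f x - of_real (\<psi> k 0) * of_real (?g x)) (moment k (of_real \<sigma>) - of_real (\<psi> k 0) * of_real (2 / \<epsilon> \<sigma>))"
      by (intro has_bochner_integral_diff moment_integrable[OF \<sigma>half_plane] has_bochner_integral_mult_right has_bochner_integral_of_real hg)
    then have "norm (moment k (of_real \<sigma>) - of_real (\<psi> k 0) * of_real (2 / \<epsilon> \<sigma>)) = norm (\<integral>x. ?f x - of_real (\<psi> k 0) * of_real (?g x) \<partial>lborel)"
      by (simp add: has_bochner_integral_iff)
    also have "\<dots> \<le> (\<integral>x. L * (indicator {-1..1} x * \<bar>x\<bar> powr (real a * \<sigma> + 1)) \<partial>lborel)"
    proof (rule norm_integral_le_integral)
      show "norm (?f x - of_real (\<psi> k 0) * of_real (?g x)) \<le> L * (indicator {-1..1} x * \<bar>x\<bar> powr (real a * \<sigma> + 1))" for x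
      proof (cases "x \<in> {-1..1}")
        case True
        have "?f x - of_real (\<psi> k 0) * of_real (?g x) = of_real (\<bar>x\<bar> powr (real a * \<sigma>) * (\<psi> k x - \<psi> k 0))"
          using True unfolding pw by (simp add: algebra_simps)
        then have "norm (?f x - of_real (\<psi> k 0) * of_real (?g x)) = \<bar>x\<bar> powr (real a * \<sigma>) * \<bar>\<psi> k x - \<psi> k 0\<bar>"
          by (simp only: norm_of_real abs_mult) simp
        also have "\<dots> \<le> \<bar>x\<bar> powr (real a * \<sigma>) * (L * \<bar>x\<bar>)"
          using Lx[OF True] by (intro mult_left_mono) auto
        also have "\<dots> = L * (\<bar>x\<bar> powr (real a * \<sigma> + 1))" by (cases "x = 0") (auto simp: powr_add)
        finally show ?thesis using True by simp
      qed auto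
    qed (use hL \<open>has_bochner_integral lborel (\<lambda>x. ?f x - of_real (\<psi> k 0) * of_real (?g x)) _\<close> in \<open>auto simp: has_bochner_integral_iff\<close>)
    also have "\<dots> = L * (2 / (\<epsilon> \<sigma> + 1))" using hL by (simp add: has_bochner_integral_iff)
    also have "\<dots> \<le> L * (2 / 1)" using e L(1) by (intro mult_left_mono divide_left_mono) auto
    finally have "norm (moment k (of_real \<sigma>) - of_real (\<psi> k 0) * of_real (2 / \<epsilon> \<sigma>)) \<le> 2 * L" by simp
    then have "\<epsilon> \<sigma> * norm (moment k (of_real \<sigma>) - of_real (\<psi> k 0) * of_real (2 / \<epsilon> \<sigma>)) \<le> \<epsilon> \<sigma> * (2 * L)"
      using e by (intro mult_left_mono) auto
    also have "\<epsilon> \<sigma> * norm (moment k (of_real \<sigma>) - of_real (\<psi> k 0) * of_real (2 / \<epsilon> \<sigma>))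
       = norm (of_real (\<epsilon> \<sigma>) * (moment k (of_real \<sigma>) - of_real (\<psi> k 0) * of_real (2 / \<epsilon> \<sigma>)))"
      using e by (simp add: norm_mult)
    also have "of_real (\<epsilon> \<sigma>) * (moment k (of_real \<sigma>) - of_real (\<psi> k 0) * of_real (2 / \<epsilon> \<sigma>)) = of_real (\<epsilon> \<sigma>) * moment k (of_real \<sigma>) - of_real (2 * \<psi> k 0)"
      using e by (simp add: right_diff_distrib)
    finally show ?case using e by (simp add: mult_ac)
  qed
  moreover have "((\<lambda>\<sigma>. 2 * L * \<epsilon> \<sigma> powr 1) \<longlongrightarrow> 0) at_abscissa"
    by (intro tendsto_mult_right_zero eps_powr_tendsto_0) auto
  ultimately have "((\<lambda>\<sigma>. of_real (\<epsilon> \<sigma>) * moment k (of_real \<sigma>) - of_real (2 * \<psi> k 0)) \<longlongrightarrow> 0) at_abscissa"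
    by (rule Lim_null_comparison)
  then show ?thesis by (simp add: LIM_zero_iff)
qed

text \<open>The remainder part grows at most like $1/\epsilon$, because only the integral in $x$ degenerates.\<close>
lemma remainder_part_tendsto:
  assumes "\<alpha> > 1"
  shows "((\<lambda>\<sigma>. of_real (\<epsilon> \<sigma> powr \<alpha>) * remainder_part (of_real \<sigma>)) \<longlongrightarrow> 0) at_abscissa"
proof -
  obtain B where B: "B \<ge> 0" "\<And>x y. x \<in> {-1..1} \<Longrightarrow> y \<in> {-1..1} \<Longrightarrow> \<bar>taylor_rem x y\<bar> \<le> B * \<bar>y\<bar> ^ b" using bounded_taylor_rem by blast
  have "eventually (\<lambda>\<sigma>. norm (of_real (\<epsilon> \<sigma> powr \<alpha>) * remainder_part (of_real \<sigma>)) \<le> 4 * B * \<epsilon> \<sigma> powr (\<alpha> - 1)) at_abscissa"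
    using eventually_at_abscissa
  proof eventually_elim
    case (elim \<sigma>)
    then have e: "\<epsilon> \<sigma> > 0" using eps_pos by simp
    have \<sigma>half_plane: "complex_of_real \<sigma> \<in> half_plane" using elim by (simp add: half_plane_def)
    have hb: "has_bochner_integral lborel (\<lambda>z::real\<times>real. B * ((indicator {-1..1} (fst z) * \<bar>fst z\<bar> powr (real a * \<sigma>)) * indicator {-1..1} (snd z))) (B * (2 / \<epsilon> \<sigma> * 2))"
      using integrable_x_powr_square[of \<sigma>] elim by (intro has_bochner_integral_mult_right) (simp add: \<epsilon>_def)
    have "norm (remainder_part (of_real \<sigma>)) \<le> (\<integral>z. B * ((indicator {-1..1} (fst (z :: real \<times> real)) * \<bar>fst z\<bar> powr (real a * \<sigma>)) * indicator {-1..1} (snd z)) \<partial>lborel)"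
      unfolding remainder_part_def
      by (rule norm_integral_le_integral[OF _ _ remainder_part_integrand_bound[OF B]])
         (use remainder_part_integrable[OF \<sigma>half_plane] hb elim in \<open>auto simp: has_bochner_integral_iff\<close>)
    also have "\<dots> = 4 * B / \<epsilon> \<sigma>" using hb by (simp add: has_bochner_integral_iff)
    finally have "\<epsilon> \<sigma> powr \<alpha> * norm (remainder_part (of_real \<sigma>)) \<le> \<epsilon> \<sigma> powr \<alpha> * (4 * B / \<epsilon> \<sigma>)"
      by (intro mult_left_mono) auto
    also have "\<dots> = 4 * B * \<epsilon> \<sigma> powr (\<alpha> - 1)" using e by (simp add: powr_diff)
    finally show ?case by (simp add: norm_mult)
  qed
  moreover have "((\<lambda>\<sigma>. 4 * B * \<epsilon> \<sigma> powr (\<alpha> - 1)) \<longlongrightarrow> 0) at_abscissa"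
    using assms by (intro tendsto_mult_right_zero eps_powr_tendsto_0) auto
  ultimately show ?thesis
    by (rule Lim_null_comparison)
qed

lemma taylor_term_tendsto:
  assumes \<alpha>: "\<alpha> > 1"
    and c: "((\<lambda>\<sigma>. (1 + (-1) ^ k) * (\<epsilon> \<sigma> powr (\<alpha> - 1) / (real b * \<sigma> + real k + 1))) \<longlongrightarrow> c) at_abscissa"
  shows "((\<lambda>\<sigma>. of_real (\<epsilon> \<sigma> powr \<alpha>) * taylor_term k (of_real \<sigma>)) \<longlongrightarrow> of_real (c / fact k * (2 * \<psi> k 0))) at_abscissa"
proof -
  have "((\<lambda>\<sigma>. of_real ((1 + (-1) ^ k) * (\<epsilon> \<sigma> powr (\<alpha> - 1) / (real b * \<sigma> + real k + 1)) / fact k) * (of_real (\<epsilon> \<sigma>) * moment k (of_real \<sigma>)))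
     \<longlongrightarrow> of_real (c / fact k) * of_real (2 * \<psi> k 0)) at_abscissa"
    by (intro tendsto_mult moment_tendsto tendsto_of_real tendsto_divide c tendsto_const) auto
  moreover have "eventually (\<lambda>\<sigma>. of_real ((1 + (-1) ^ k) * (\<epsilon> \<sigma> powr (\<alpha> - 1) / (real b * \<sigma> + real k + 1)) / fact k) * (of_real (\<epsilon> \<sigma>) * moment k (of_real \<sigma>))
     = of_real (\<epsilon> \<sigma> powr \<alpha>) * taylor_term k (of_real \<sigma>)) at_abscissa"
    using eventually_at_abscissa
  proof eventually_elim
    case (elim \<sigma>)
    then have e: "\<epsilon> \<sigma> > 0" using eps_pos by simp
    have "\<epsilon> \<sigma> powr \<alpha> = \<epsilon> \<sigma> powr (\<alpha> - 1) * \<epsilon> \<sigma>" using e by (simp add: powr_diff)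
    then show ?case by (simp add: taylor_term_def mult_ac)
  qed
  ultimately show ?thesis by (simp add: Lim_transform_eventually)
qed

text \<open>The denominator is $\frac ba\epsilon + (k+1-b/a)$. Without resonance it stays away from zero; with resonance it
costs one power of $\epsilon$, which is harmless once $\alpha>2$.\<close>
lemma taylor_term_coeff_tendsto_0:
  assumes \<alpha>: "\<alpha> > 1" and k: "odd k \<or> real b \<noteq> real a * (real k + 1) \<or> \<alpha> > 2"
  shows "((\<lambda>\<sigma>. (1 + (-1) ^ k) * (\<epsilon> \<sigma> powr (\<alpha> - 1) / (real b * \<sigma> + real k + 1))) \<longlongrightarrow> 0) at_abscissa"
proof -
  consider "odd k" | "real b \<noteq> real a * (real k + 1)" | "real b = real a * (real k + 1)" "\<alpha> > 2" using k by blast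
  then show ?thesis
  proof cases
    case 2
    have "((\<lambda>\<sigma>. (1 + (-1) ^ k) * (\<epsilon> \<sigma> powr (\<alpha> - 1) / (real b * \<sigma> + real k + 1))) \<longlongrightarrow>
       (1 + (-1) ^ k) * (0 / (real b * (- 1 / real a) + real k + 1))) at_abscissa"
      using \<alpha> 2 a0 by (intro tendsto_intros eps_powr_tendsto_0) (auto simp: field_simps)
    then show ?thesis by simp
  next
    case 3
    have "((\<lambda>\<sigma>. (1 + (-1) ^ k) * (real a / real b * \<epsilon> \<sigma> powr (\<alpha> - 2))) \<longlongrightarrow> (1 + (-1) ^ k) * (real a / real b * 0)) at_abscissa"
      using 3 by (intro tendsto_intros eps_powr_tendsto_0) auto
    moreover have "eventually (\<lambda>\<sigma>. (1 + (-1) ^ k) * (real a / real b * \<epsilon> \<sigma> powr (\<alpha> - 2)) = (1 + (-1) ^ k) * (\<epsilon> \<sigma> powr (\<alpha> - 1) / (real b * \<sigma> + real k + 1))) at_abscissa"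
      using eventually_at_abscissa
    proof eventually_elim
      case (elim \<sigma>)
      then have e: "\<epsilon> \<sigma> > 0" using eps_pos by simp
      have "real b * \<sigma> + real k + 1 = real b / real a * \<epsilon> \<sigma>" using 3(1) a0 by (simp add: \<epsilon>_def field_simps)
      moreover have "\<epsilon> \<sigma> powr (\<alpha> - 1) = \<epsilon> \<sigma> powr (\<alpha> - 2) * \<epsilon> \<sigma>" using e by (simp add: powr_diff power2_eq_square)
      ultimately show ?case using e a0 b0 by simp
    qed
    ultimately show ?thesis by (simp add: Lim_transform_eventually)
  qed simp
qed

text \<open>Under resonance the denominator equals $\frac ba\epsilon$ exactly, so the quotient is constant.\<close>
lemma taylor_term_coeff_tendsto_resonant:
  assumes "even k" "real b = real a * (real k + 1)"
  shows "((\<lambda>\<sigma>. (1 + (-1) ^ k) * (\<epsilon> \<sigma> powr (2 - 1) / (real b * \<sigma> + real k + 1))) \<longlongrightarrow> 2 * real a / real b) at_abscissa"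
proof (rule tendsto_eventually)
  show "eventually (\<lambda>\<sigma>. (1 + (-1) ^ k) * (\<epsilon> \<sigma> powr (2 - 1) / (real b * \<sigma> + real k + 1)) = 2 * real a / real b) at_abscissa"
    using eventually_at_abscissa
  proof eventually_elim
    case (elim \<sigma>)
    then have e: "\<epsilon> \<sigma> > 0" using eps_pos by simp
    have "real b * \<sigma> + real k + 1 = real b / real a * \<epsilon> \<sigma>" using assms(2) a0 by (simp add: \<epsilon>_def field_simps)
    then show ?case using e a0 b0 assms(1) by simp
  qed
qed

section \<open>The flat part at the abscissa\<close>

text \<open>The extra exponent \<open>c\<close> is 0 for the main term and 1 for the error made by replacing $\varphi(0,y)$ by $\varphi(0,0)$.\<close>
definition kernel_integral :: "real \<Rightarrow> real \<Rightarrow> real" where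
  "kernel_integral c \<sigma> = (\<integral>y. indicator {-1..1} y * (\<bar>y\<bar> powr (real b * \<sigma> + c) * flat_exp p y powr (\<epsilon> \<sigma> / real q)) \<partial>lborel)"

lemma kernel_integral_bound:
  assumes \<eta>: "\<eta> > 0" and ex: "c - real b / real a + p * \<eta> > -1" and \<sigma>: "- 1 / real a < \<sigma>"
  shows "integrable lborel (\<lambda>y. indicator {-1..1} y * (\<bar>y\<bar> powr (real b * \<sigma> + c) * flat_exp p y powr (\<epsilon> \<sigma> / real q)))"
    and "kernel_integral c \<sigma> \<le> 2 * \<eta> powr \<eta> / (c - real b / real a + p * \<eta> + 1) * real q powr \<eta> * \<epsilon> \<sigma> powr (- \<eta>)"
proof -
  have e: "\<epsilon> \<sigma> > 0" using eps_pos[OF \<sigma>] .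
  have "real b * (- 1 / real a) \<le> real b * \<sigma>" using \<sigma> by (intro mult_left_mono) auto
  then have mu: "c - real b / real a \<le> real b * \<sigma> + c" by simp
  note * = flat_kernel_integral_le[OF \<eta> ex mu, of "\<epsilon> \<sigma> / real q"]
  show "integrable lborel (\<lambda>y. indicator {-1..1} y * (\<bar>y\<bar> powr (real b * \<sigma> + c) * flat_exp p y powr (\<epsilon> \<sigma> / real q)))"
    using *(1) e q0 by simp
  have "(\<epsilon> \<sigma> / real q) powr (- \<eta>) = real q powr \<eta> * \<epsilon> \<sigma> powr (- \<eta>)"
    using e q0 by (simp add: powr_divide powr_minus divide_simps)
  then show "kernel_integral c \<sigma> \<le> 2 * \<eta> powr \<eta> / (c - real b / real a + p * \<eta> + 1) * real q powr \<eta> * \<epsilon> \<sigma> powr (- \<eta>)"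
    using *(2) e q0 by (simp add: kernel_integral_def mult.assoc)
qed

lemma kernel_integral_nonneg: "kernel_integral c \<sigma> \<ge> 0"
  unfolding kernel_integral_def by (intro Bochner_Integration.integral_nonneg) (auto simp: indicator_def)

text \<open>The kernel integral grows no faster than $\epsilon^{-\eta}$ for any admissible \<open>\<eta>\<close>, and admissibility,
$p\eta>b/a-1-c$, is an open condition. This makes crude bounds enough for every error term.\<close>
lemma eps_powr_kernel_integral_tendsto_0:
  assumes \<eta>: "\<eta> > 0" "\<eta> < \<alpha>" and ex: "c - real b / real a + p * \<eta> > -1"
  shows "((\<lambda>\<sigma>. \<epsilon> \<sigma> powr \<alpha> * kernel_integral c \<sigma>) \<longlongrightarrow> 0) at_abscissa"
proof -
  define K where "K = 2 * \<eta> powr \<eta> / (c - real b / real a + p * \<eta> + 1) * real q powr \<eta>"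
  have "eventually (\<lambda>\<sigma>. norm (\<epsilon> \<sigma> powr \<alpha> * kernel_integral c \<sigma>) \<le> K * \<epsilon> \<sigma> powr (\<alpha> - \<eta>)) at_abscissa"
    using eventually_at_abscissa
  proof eventually_elim
    case (elim \<sigma>)
    then have "\<epsilon> \<sigma> powr \<alpha> * kernel_integral c \<sigma> \<le> \<epsilon> \<sigma> powr \<alpha> * (K * \<epsilon> \<sigma> powr (- \<eta>))"
      using kernel_integral_bound(2)[OF \<eta>(1) ex] by (intro mult_left_mono) (auto simp: K_def)
    also have "\<dots> = K * \<epsilon> \<sigma> powr (\<alpha> - \<eta>)" by (simp add: powr_diff powr_minus divide_inverse)
    finally show ?case using kernel_integral_nonneg[of c \<sigma>] by simp
  qed
  moreover have "((\<lambda>\<sigma>. K * \<epsilon> \<sigma> powr (\<alpha> - \<eta>)) \<longlongrightarrow> 0) at_abscissa"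
    using \<eta> by (intro tendsto_mult_right_zero eps_powr_tendsto_0) auto
  ultimately show ?thesis by (rule Lim_null_comparison)
qed

lemma kernel_integral_tendsto:
  assumes ba: "real b > real a"
  defines "\<delta> \<equiv> (real b / real a - 1) / p"
  shows "((\<lambda>\<sigma>. \<epsilon> \<sigma> powr \<delta> * kernel_integral 0 \<sigma>) \<longlongrightarrow> 2 * real q powr \<delta> * Gamma \<delta> / p) at_abscissa"
proof -
  have \<delta>: "\<delta> > 0" using ba a0 p0 by (simp add: \<delta>_def)
  define \<kappa> where "\<kappa> = real b * real q / real a"
  have \<tau>: "filterlim (\<lambda>\<sigma>. \<epsilon> \<sigma> / real q) (at_right 0) at_abscissa"
  proof (rule filterlim_compose[OF _ eps_tendsto])
    show "filterlim (\<lambda>t. t / real q) (at_right 0) (at_right 0)" using q0 by real_asymp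
  qed
  have "((\<lambda>\<sigma>. real q powr \<delta> * ((\<epsilon> \<sigma> / real q) powr \<delta> * (\<integral>y. indicator {-1..1} y * (\<bar>y\<bar> powr (- 1 - p * \<delta> + \<kappa> * (\<epsilon> \<sigma> / real q)) * flat_exp p y powr (\<epsilon> \<sigma> / real q)) \<partial>lborel)))
      \<longlongrightarrow> real q powr \<delta> * (2 * Gamma \<delta> / p)) at_abscissa"
    using filterlim_compose[OF flat_kernel_integral_tendsto[OF p0 \<delta>, of \<kappa>] \<tau>] a0 b0 q0
    by (intro tendsto_mult_left) (simp add: \<kappa>_def)
  moreover have "eventually (\<lambda>\<sigma>. real q powr \<delta> * ((\<epsilon> \<sigma> / real q) powr \<delta> * (\<integral>y. indicator {-1..1} y * (\<bar>y\<bar> powr (- 1 - p * \<delta> + \<kappa> * (\<epsilon> \<sigma> / real q)) * flat_exp p y powr (\<epsilon> \<sigma> / real q)) \<partial>lborel))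
      = \<epsilon> \<sigma> powr \<delta> * kernel_integral 0 \<sigma>) at_abscissa"
    using eventually_at_abscissa
  proof eventually_elim
    case (elim \<sigma>)
    have e: "\<epsilon> \<sigma> > 0" using eps_pos elim by simp
    have "p * \<delta> = real b / real a - 1" using p0 by (simp add: \<delta>_def)
    moreover have "\<kappa> * (\<epsilon> \<sigma> / real q) = real b * \<sigma> + real b / real a"
      using a0 q0 by (simp add: \<kappa>_def \<epsilon>_def field_simps)
    ultimately have "- 1 - p * \<delta> + \<kappa> * (\<epsilon> \<sigma> / real q) = real b * \<sigma> + 0"
      by linarith
    moreover have "real q powr \<delta> * (\<epsilon> \<sigma> / real q) powr \<delta> = \<epsilon> \<sigma> powr \<delta>" using e q0 by (simp add: powr_divide)
    ultimately show ?case unfolding kernel_integral_def by (simp only: mult.assoc[symmetric])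
  qed
  ultimately have "((\<lambda>\<sigma>. \<epsilon> \<sigma> powr \<delta> * kernel_integral 0 \<sigma>) \<longlongrightarrow> real q powr \<delta> * (2 * Gamma \<delta> / p)) at_abscissa"
    by (rule Lim_transform_eventually)
  then show ?thesis by (simp add: mult_ac)
qed

lemma flat_integrand_real:
  "flat_integrand (of_real \<sigma>) (x, y) = of_real (\<bar>y\<bar> powr (real b * \<sigma>) *
     (indicator {-1..1} x * (\<bar>x\<bar> powr (real a * \<sigma>) * ((1 + flat_ratio x y) powr \<sigma> - 1) * \<phi> (x, y))))"
proof -
  have pw: "complex_of_real \<bar>u\<bar> powr (of_nat n * of_real \<sigma>) = of_real (\<bar>u\<bar> powr (real n * \<sigma>))" for u n
    using powr_of_real[of "\<bar>u\<bar>" "real n * \<sigma>"] by simp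
  have pw1: "complex_of_real \<bar>1 + flat_ratio x y\<bar> powr of_real \<sigma> = of_real ((1 + flat_ratio x y) powr \<sigma>)"
    using powr_of_real[of "\<bar>1 + flat_ratio x y\<bar>" "\<sigma>"] flat_ratio_nonneg[of x y] by simp
  have "indicator {-1..1} x * \<phi> (x, y) = \<phi> (x, y)"
    using supp_outside[of x y] by (auto simp: indicator_def)
  then show ?thesis by (auto simp: flat_integrand_def pw pw1 indicator_def)
qed

text \<open>Integrate first in $x$ for fixed $y$, then in $y$. The error in the first step is uniform in
$\sigma$ except for the constant deviation $|\varphi(0,y)-\varphi(0,0)|=O(|y|)$, which carries $1/\epsilon$ but raises the exponent
of $|y|$ by one.\<close>
lemma flat_part_approx:
  obtains C1 C2 where "C1 \<ge> 0" "C2 \<ge> 0" "\<And>\<sigma>. - 1 / real a < \<sigma> \<Longrightarrow> \<sigma> < 0 \<Longrightarrow>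
    norm (flat_part (of_real \<sigma>) + of_real (2 * \<phi> (0, 0) / \<epsilon> \<sigma> * kernel_integral 0 \<sigma>)) \<le> C1 * kernel_integral 0 \<sigma> + C2 / \<epsilon> \<sigma> * kernel_integral 1 \<sigma>"
proof -
  obtain M where M: "M \<ge> 0" "\<And>z. \<bar>\<phi> z\<bar> \<le> M" using bounded_phi by blast
  obtain L where L: "L \<ge> 0" "\<And>x y. x \<in> {-1..1} \<Longrightarrow> y \<in> {-1..1} \<Longrightarrow> \<bar>\<phi> (x, y) - \<phi> (0, 0)\<bar> \<le> L * \<bar>x\<bar> + L * \<bar>y\<bar>"
    using smooth_difference_bound[OF smooth] by blast
  define C1 where "C1 = 2 * (real a + 1) * M + 2 * L"
  have C1: "C1 \<ge> 0" using M(1) L(1) by (simp add: C1_def)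
  show thesis
  proof (rule that[OF C1, of "2 * L"])
    fix \<sigma> assume \<sigma>: "- 1 / real a < \<sigma>" "\<sigma> < 0"
    have e: "\<epsilon> \<sigma> > 0" using eps_pos[OF \<sigma>(1)] .
    define f where "f x y = \<bar>y\<bar> powr (real b * \<sigma>) *
       (indicator {-1..1} x * (\<bar>x\<bar> powr (real a * \<sigma>) * ((1 + flat_ratio x y) powr \<sigma> - 1) * \<phi> (x, y)))" for x y
    define k where "k c y = indicator {-1..1} y * (\<bar>y\<bar> powr (real b * \<sigma> + c) * flat_exp p y powr (\<epsilon> \<sigma> / real q))" for c y
    define K where "K y = (\<integral>x. f x y \<partial>lborel)" for y
    have \<sigma>half_plane: "complex_of_real \<sigma> \<in> half_plane" using \<sigma> by (simp add: half_plane_def)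
    have "flat_integrand (of_real \<sigma>) = (\<lambda>z. complex_of_real (case_prod f z))"
      by (auto simp: fun_eq_iff flat_integrand_real f_def)
    then have Df: "integrable (lborel \<Otimes>\<^sub>M lborel) (case_prod f)" "flat_part (of_real \<sigma>) = of_real (integral\<^sup>L (lborel \<Otimes>\<^sub>M lborel) (case_prod f))"
      using flat_part_integrable[OF \<sigma>half_plane] by (simp_all add: flat_part_def complex_of_real_integrable_eq lborel_prod)
    have DK: "flat_part (of_real \<sigma>) = of_real (\<integral>y. K y \<partial>lborel)"
      using lborel_pair.integral_snd[OF Df(1)] Df(2) by (simp add: K_def)
    have Kint: "integrable lborel K" unfolding K_def by (rule lborel_pair.integrable_snd[OF Df(1)])
    \<comment> \<open>Any exponent large enough for integrability serves here, since only the existence of the kernel integrals is used.\<close>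
    define \<eta> where "\<eta> = real b / real a / p"
    have \<eta>: "\<eta> > 0" "0 - real b / real a + p * \<eta> > -1" "1 - real b / real a + p * \<eta> > -1"
      using a0 b0 p0 by (auto simp: \<eta>_def)
    have kint: "integrable lborel (k 0)" "integrable lborel (k 1)"
      unfolding k_def using kernel_integral_bound(1)[OF \<eta>(1,2) \<sigma>(1)] kernel_integral_bound(1)[OF \<eta>(1,3) \<sigma>(1)] by simp_all
    have kJ: "integral\<^sup>L lborel (k c) = kernel_integral c \<sigma>" for c by (simp add: k_def[abs_def] kernel_integral_def)
    have pt: "\<bar>K y + 2 * \<phi> (0, 0) / \<epsilon> \<sigma> * k 0 y\<bar> \<le> C1 * k 0 y + 2 * L / \<epsilon> \<sigma> * k 1 y" for y
    proof (cases "y \<in> {-1..1} - {0}")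
      case False
      then have "f x y = 0" for x using supp_outside[of x y] by (auto simp: f_def)
      then have "K y = 0" by (simp add: K_def)
      moreover have "k c y = 0" for c using False by (auto simp: k_def)
      ultimately show ?thesis by simp
    next
      case True
      let ?fl = "flat_exp p y powr (\<epsilon> \<sigma> / real q)"
      let ?X = "\<integral>x. indicator {-1..1} x * (\<bar>x\<bar> powr (real a * \<sigma>) * ((1 + flat_ratio x y) powr \<sigma> - 1) * \<phi> (x, y)) \<partial>lborel"
      have KX: "K y = \<bar>y\<bar> powr (real b * \<sigma>) * ?X"
        unfolding K_def f_def by (rule integral_mult_right_zero)
      have meas: "(\<lambda>x. \<phi> (x, y)) \<in> borel_measurable borel"
        by (intro borel_measurable_continuous_onI continuous_on_compose2[OF smooth_imp_continuous_on[OF smooth, of UNIV]])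
           (auto intro!: continuous_intros)
      have "\<bar>?X + 2 * ?fl / \<epsilon> \<sigma> * \<phi> (0, 0)\<bar> \<le> (2 * (real a + 1) * M + 2 * L + 2 * (L * \<bar>y\<bar>) / \<epsilon> \<sigma>) * ?fl"
        unfolding flat_ratio_def \<epsilon>_def
      proof (intro flat_perturbation_x_integral meas q2 qa evenq \<sigma> flat_exp_pos flat_exp_bounds)
        show "\<bar>\<phi> (x, y) - \<phi> (0, 0)\<bar> \<le> L * \<bar>x\<bar> + L * \<bar>y\<bar>" if "\<bar>x\<bar> \<le> 1" for x
        proof -
          have "x \<in> {-1..1}" using that by auto
          then show ?thesis using L(2)[of x y] True by auto
        qed
      qed (use True M L in auto)
      then have "\<bar>y\<bar> powr (real b * \<sigma>) * \<bar>?X + 2 * ?fl / \<epsilon> \<sigma> * \<phi> (0, 0)\<bar> \<le>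
         \<bar>y\<bar> powr (real b * \<sigma>) * ((2 * (real a + 1) * M + 2 * L + 2 * (L * \<bar>y\<bar>) / \<epsilon> \<sigma>) * ?fl)"
        by (intro mult_left_mono) auto
      also have "\<bar>y\<bar> powr (real b * \<sigma>) * \<bar>?X + 2 * ?fl / \<epsilon> \<sigma> * \<phi> (0, 0)\<bar> = \<bar>\<bar>y\<bar> powr (real b * \<sigma>) * (?X + 2 * ?fl / \<epsilon> \<sigma> * \<phi> (0, 0))\<bar>"
        by (simp add: abs_mult)
      also have "\<bar>y\<bar> powr (real b * \<sigma>) * (?X + 2 * ?fl / \<epsilon> \<sigma> * \<phi> (0, 0)) = K y + 2 * \<phi> (0, 0) / \<epsilon> \<sigma> * k 0 y"
        unfolding KX using True by (simp add: k_def distrib_left mult_ac)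
      also have "\<bar>y\<bar> powr (real b * \<sigma>) * ((2 * (real a + 1) * M + 2 * L + 2 * (L * \<bar>y\<bar>) / \<epsilon> \<sigma>) * ?fl)
         = C1 * k 0 y + 2 * L / \<epsilon> \<sigma> * k 1 y"
        unfolding C1_def[symmetric] using True by (simp add: k_def powr_add distrib_left distrib_right mult_ac)
      finally show ?thesis .
    qed
    have "flat_part (of_real \<sigma>) + of_real (2 * \<phi> (0, 0) / \<epsilon> \<sigma> * kernel_integral 0 \<sigma>) = of_real (\<integral>y. K y + 2 * \<phi> (0, 0) / \<epsilon> \<sigma> * k 0 y \<partial>lborel)"
      using Kint kint(1) by (simp add: DK kJ)
    then have "norm (flat_part (of_real \<sigma>) + of_real (2 * \<phi> (0, 0) / \<epsilon> \<sigma> * kernel_integral 0 \<sigma>)) = norm (\<integral>y. K y + 2 * \<phi> (0, 0) / \<epsilon> \<sigma> * k 0 y \<partial>lborel)"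
      by (simp only: norm_of_real real_norm_def)
    also have "\<dots> \<le> (\<integral>y. C1 * k 0 y + 2 * L / \<epsilon> \<sigma> * k 1 y \<partial>lborel)"
      by (rule norm_integral_le_integral) (use Kint kint pt in auto)
    also have "\<dots> = C1 * kernel_integral 0 \<sigma> + 2 * L / \<epsilon> \<sigma> * kernel_integral 1 \<sigma>" using kint by (simp add: kJ)
    finally show "norm (flat_part (of_real \<sigma>) + of_real (2 * \<phi> (0, 0) / \<epsilon> \<sigma> * kernel_integral 0 \<sigma>)) \<le> C1 * kernel_integral 0 \<sigma> + 2 * L / \<epsilon> \<sigma> * kernel_integral 1 \<sigma>" .
  qed (use L in auto)
qed

lemma flat_part_remainder_tendsto_0:
  assumes "((\<lambda>\<sigma>. \<epsilon> \<sigma> powr \<alpha> * kernel_integral 0 \<sigma>) \<longlongrightarrow> 0) at_abscissa" "((\<lambda>\<sigma>. \<epsilon> \<sigma> powr (\<alpha> - 1) * kernel_integral 1 \<sigma>) \<longlongrightarrow> 0) at_abscissa"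
  shows "((\<lambda>\<sigma>. of_real (\<epsilon> \<sigma> powr \<alpha>) * (flat_part (of_real \<sigma>) + of_real (2 * \<phi> (0, 0) / \<epsilon> \<sigma> * kernel_integral 0 \<sigma>))) \<longlongrightarrow> 0) at_abscissa"
proof -
  obtain C1 C2 where C: "C1 \<ge> 0" "C2 \<ge> 0" "\<And>\<sigma>. - 1 / real a < \<sigma> \<Longrightarrow> \<sigma> < 0 \<Longrightarrow>
    norm (flat_part (of_real \<sigma>) + of_real (2 * \<phi> (0, 0) / \<epsilon> \<sigma> * kernel_integral 0 \<sigma>)) \<le> C1 * kernel_integral 0 \<sigma> + C2 / \<epsilon> \<sigma> * kernel_integral 1 \<sigma>"
    using flat_part_approx by blast
  have "eventually (\<lambda>\<sigma>. norm (of_real (\<epsilon> \<sigma> powr \<alpha>) * (flat_part (of_real \<sigma>) + of_real (2 * \<phi> (0, 0) / \<epsilon> \<sigma> * kernel_integral 0 \<sigma>)))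
     \<le> C1 * (\<epsilon> \<sigma> powr \<alpha> * kernel_integral 0 \<sigma>) + C2 * (\<epsilon> \<sigma> powr (\<alpha> - 1) * kernel_integral 1 \<sigma>)) at_abscissa"
    using eventually_at_abscissa
  proof eventually_elim
    case (elim \<sigma>)
    have e: "\<epsilon> \<sigma> > 0" using eps_pos elim by simp
    have "norm (of_real (\<epsilon> \<sigma> powr \<alpha>) * (flat_part (of_real \<sigma>) + of_real (2 * \<phi> (0, 0) / \<epsilon> \<sigma> * kernel_integral 0 \<sigma>)))
       = \<epsilon> \<sigma> powr \<alpha> * norm (flat_part (of_real \<sigma>) + of_real (2 * \<phi> (0, 0) / \<epsilon> \<sigma> * kernel_integral 0 \<sigma>))"
      by (simp only: norm_mult norm_of_real abs_of_nonneg powr_ge_zero)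
    also have "\<dots> \<le> \<epsilon> \<sigma> powr \<alpha> * (C1 * kernel_integral 0 \<sigma> + C2 / \<epsilon> \<sigma> * kernel_integral 1 \<sigma>)"
      using elim by (intro mult_left_mono C(3)) auto
    also have "\<dots> = C1 * (\<epsilon> \<sigma> powr \<alpha> * kernel_integral 0 \<sigma>) + C2 * (\<epsilon> \<sigma> powr (\<alpha> - 1) * kernel_integral 1 \<sigma>)"
      using e by (simp add: powr_diff distrib_left mult_ac)
    finally show ?case .
  qed
  moreover have "((\<lambda>\<sigma>. C1 * (\<epsilon> \<sigma> powr \<alpha> * kernel_integral 0 \<sigma>) + C2 * (\<epsilon> \<sigma> powr (\<alpha> - 1) * kernel_integral 1 \<sigma>)) \<longlongrightarrow> 0) at_abscissa"
    by (intro tendsto_add_zero tendsto_mult_right_zero assms)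
  ultimately show ?thesis by (rule Lim_null_comparison)
qed

text \<open>The hypothesis $b>a$ makes $\delta$ positive, so the kernel integral of the main term $\frac{2}{\epsilon}\varphi(0,0)$ has the exact order
$\epsilon^{-\delta}$, and both errors are of strictly smaller order than $\epsilon^{-1-\delta}$.\<close>
lemma flat_part_tendsto:
  assumes ba: "real b > real a"
  defines "\<delta> \<equiv> (real b / real a - 1) / p"
  shows "((\<lambda>\<sigma>. of_real (\<epsilon> \<sigma> powr (1 + \<delta>)) * flat_part (of_real \<sigma>)) \<longlongrightarrow> of_real (- 4 * leading_const a b q p * \<phi> (0, 0))) at_abscissa"
proof -
  have \<delta>: "\<delta> > 0" using ba a0 p0 by (simp add: \<delta>_def)
  have pd: "p * \<delta> = real b / real a - 1" using p0 by (simp add: \<delta>_def)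
  have J0: "((\<lambda>\<sigma>. \<epsilon> \<sigma> powr (1 + \<delta>) * kernel_integral 0 \<sigma>) \<longlongrightarrow> 0) at_abscissa"
    by (rule eps_powr_kernel_integral_tendsto_0[of "\<delta> + 1/2"]) (use \<delta> pd p0 in \<open>auto simp: distrib_left\<close>)
  have J1: "((\<lambda>\<sigma>. \<epsilon> \<sigma> powr (1 + \<delta> - 1) * kernel_integral 1 \<sigma>) \<longlongrightarrow> 0) at_abscissa"
  proof -
    \<comment> \<open>Less than \<open>\<delta>\<close> by so little that \<open>p * \<eta>\<close> still exceeds \<open>p * \<delta> - 1\<close>, and nevertheless positive.\<close>
    define \<eta> where "\<eta> = \<delta> - min (\<delta> / 2) (1 / (2 * p))"
    have "p * min (\<delta> / 2) (1 / (2 * p)) \<le> p * (1 / (2 * p))" using p0 by (intro mult_left_mono) auto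
    then have "p * min (\<delta> / 2) (1 / (2 * p)) < 1" using p0 by simp
    moreover have "0 < \<eta>" "\<eta> < \<delta>" using \<delta> p0 by (auto simp: \<eta>_def min_less_iff_disj)
    ultimately show ?thesis using pd
      by (intro eps_powr_kernel_integral_tendsto_0[of \<eta>]) (auto simp: \<eta>_def right_diff_distrib)
  qed
  have "((\<lambda>\<sigma>. of_real (\<epsilon> \<sigma> powr (1 + \<delta>)) * (flat_part (of_real \<sigma>) + of_real (2 * \<phi> (0, 0) / \<epsilon> \<sigma> * kernel_integral 0 \<sigma>))
       - of_real (2 * \<phi> (0, 0) * (\<epsilon> \<sigma> powr \<delta> * kernel_integral 0 \<sigma>)))
     \<longlongrightarrow> 0 - of_real (2 * \<phi> (0, 0) * (2 * real q powr \<delta> * Gamma \<delta> / p))) at_abscissa"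
    using kernel_integral_tendsto[OF ba] flat_part_remainder_tendsto_0[OF J0 J1] unfolding \<delta>_def[symmetric]
    by (intro tendsto_diff tendsto_of_real tendsto_mult_left)
  moreover have "eventually (\<lambda>\<sigma>. of_real (\<epsilon> \<sigma> powr (1 + \<delta>)) * (flat_part (of_real \<sigma>) + of_real (2 * \<phi> (0, 0) / \<epsilon> \<sigma> * kernel_integral 0 \<sigma>))
       - of_real (2 * \<phi> (0, 0) * (\<epsilon> \<sigma> powr \<delta> * kernel_integral 0 \<sigma>)) = of_real (\<epsilon> \<sigma> powr (1 + \<delta>)) * flat_part (of_real \<sigma>)) at_abscissa"
    using eventually_at_abscissa
  proof eventually_elim
    case (elim \<sigma>)
    have e: "\<epsilon> \<sigma> > 0" using eps_pos elim by simp
    then have "\<epsilon> \<sigma> powr (1 + \<delta>) = \<epsilon> \<sigma> * \<epsilon> \<sigma> powr \<delta>" by (simp add: powr_add)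
    with e show ?case by (simp add: distrib_left mult_ac)
  qed
  ultimately have lim: "((\<lambda>\<sigma>. of_real (\<epsilon> \<sigma> powr (1 + \<delta>)) * flat_part (of_real \<sigma>)) \<longlongrightarrow> 0 - of_real (2 * \<phi> (0, 0) * (2 * real q powr \<delta> * Gamma \<delta> / p))) at_abscissa"
    by (rule Lim_transform_eventually)
  have "Gamma (1 + \<delta>) = \<delta> * Gamma \<delta>" using Gamma_plus1[of \<delta>] \<delta> by (auto simp: add.commute nonpos_Ints_def)
  then have "leading_const a b q p = real q powr \<delta> * Gamma \<delta> / p"
    unfolding leading_const_def \<delta>_def[symmetric] pd[symmetric] using \<delta> p0 by simp
  then have "0 - of_real (2 * \<phi> (0, 0) * (2 * real q powr \<delta> * Gamma \<delta> / p)) = complex_of_real (- 4 * leading_const a b q p * \<phi> (0, 0))"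
    by simp
  with lim show ?thesis by (simp only:)
qed

text \<open>Here $\delta<1$, so an exponent strictly between $\delta$ and $1$ bounds the kernel integral, also when $a=b$, where $\delta=0$ and it
grows logarithmically.\<close>
lemma flat_part_tendsto_0:
  assumes "p > real b / real a - 1"
  shows "((\<lambda>\<sigma>. of_real (\<epsilon> \<sigma> powr 2) * flat_part (of_real \<sigma>)) \<longlongrightarrow> 0) at_abscissa"
proof -
  define \<delta> where "\<delta> = (real b / real a - 1) / p"
  have "real b / real a \<ge> 1" using ab a0 by simp
  then have \<delta>: "\<delta> \<ge> 0" "\<delta> < 1" using assms p0 by (auto simp: \<delta>_def)
  have pd: "p * \<delta> = real b / real a - 1" using p0 by (simp add: \<delta>_def)
  define \<eta> where "\<eta> = (1 + \<delta>) / 2"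
  have \<eta>: "0 < \<eta>" "\<eta> < 1" "\<delta> < \<eta>" using \<delta> by (auto simp: \<eta>_def)
  have "p * \<delta> < p * \<eta>" using \<eta> p0 by simp
  then have ex: "0 - real b / real a + p * \<eta> > -1" "1 - real b / real a + p * \<eta> > -1" using pd by auto
  have J0: "((\<lambda>\<sigma>. \<epsilon> \<sigma> powr 1 * kernel_integral 0 \<sigma>) \<longlongrightarrow> 0) at_abscissa" "((\<lambda>\<sigma>. \<epsilon> \<sigma> powr 2 * kernel_integral 0 \<sigma>) \<longlongrightarrow> 0) at_abscissa"
    by (rule eps_powr_kernel_integral_tendsto_0[OF \<eta>(1) _ ex(1)]; use \<eta> in simp)+
  have J1: "((\<lambda>\<sigma>. \<epsilon> \<sigma> powr (2 - 1) * kernel_integral 1 \<sigma>) \<longlongrightarrow> 0) at_abscissa"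
    by (rule eps_powr_kernel_integral_tendsto_0[OF \<eta>(1) _ ex(2)]) (use \<eta> in simp)
  have "((\<lambda>\<sigma>. of_real (\<epsilon> \<sigma> powr 2) * (flat_part (of_real \<sigma>) + of_real (2 * \<phi> (0, 0) / \<epsilon> \<sigma> * kernel_integral 0 \<sigma>))
       - of_real (2 * \<phi> (0, 0) * (\<epsilon> \<sigma> powr 1 * kernel_integral 0 \<sigma>)))
     \<longlongrightarrow> 0 - of_real (2 * \<phi> (0, 0) * 0)) at_abscissa"
    by (intro tendsto_diff tendsto_of_real tendsto_mult_left flat_part_remainder_tendsto_0 J0 J1)
  moreover have "eventually (\<lambda>\<sigma>. of_real (\<epsilon> \<sigma> powr 2) * (flat_part (of_real \<sigma>) + of_real (2 * \<phi> (0, 0) / \<epsilon> \<sigma> * kernel_integral 0 \<sigma>))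
       - of_real (2 * \<phi> (0, 0) * (\<epsilon> \<sigma> powr 1 * kernel_integral 0 \<sigma>)) = of_real (\<epsilon> \<sigma> powr 2) * flat_part (of_real \<sigma>)) at_abscissa"
    using eventually_at_abscissa
  proof eventually_elim
    case (elim \<sigma>)
    have e: "\<epsilon> \<sigma> > 0" using eps_pos elim by simp
    then have "\<epsilon> \<sigma> powr 2 = \<epsilon> \<sigma> * \<epsilon> \<sigma> powr 1" by (simp add: power2_eq_square)
    with e show ?case by (simp add: distrib_left mult_ac)
  qed
  ultimately have "((\<lambda>\<sigma>. of_real (\<epsilon> \<sigma> powr 2) * flat_part (of_real \<sigma>)) \<longlongrightarrow> 0 - of_real (2 * \<phi> (0, 0) * 0)) at_abscissa"
    by (rule Lim_transform_eventually)
  then show ?thesis by simp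
qed

text \<open>Removing the singularities assigns the values required of a nicely meromorphic function at points where
\<open>continuation\<close> merely contains a division by zero.\<close>
definition Z :: "complex \<Rightarrow> complex" where "Z = remove_sings continuation"

lemma Z_eq: "s \<in> regular_points \<Longrightarrow> Z s = continuation s"
  unfolding Z_def using continuation_analytic by (intro remove_sings_at_analytic) (auto simp: analytic_on_def)

lemma Z_nicely_meromorphic: "Z nicely_meromorphic_on half_plane"
  unfolding Z_def by (rule remove_sings_nicely_meromorphic[OF continuation_meromorphic])

lemma Z_pole:
  assumes "s \<in> half_plane" "is_pole Z s"
  shows "s \<notin> regular_points"
proof
  assume "s \<in> regular_points"
  then have "continuation analytic_on {s}" using continuation_analytic analytic_on_subset by blast
  then have "Z analytic_on {s}" unfolding Z_def by (rule remove_sings_analytic_on)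
  with assms(2) show False using analytic_at_imp_no_pole by blast
qed

lemma eventually_in_regular_points: "eventually (\<lambda>\<sigma>. complex_of_real \<sigma> \<in> regular_points) at_abscissa"
proof -
  have "eventually (\<lambda>\<sigma>. \<forall>k\<in>{..<b}. \<sigma> \<noteq> - (real k + 1) / real b) at_abscissa"
    by (intro eventually_ball_finite ballI eventually_neq_at_within) auto
  with eventually_at_abscissa show ?thesis
  proof eventually_elim
    case (elim \<sigma>)
    have "of_nat b * complex_of_real \<sigma> + of_nat k + 1 \<noteq> 0" if "k < b" for k
    proof
      assume "of_nat b * complex_of_real \<sigma> + of_nat k + 1 = 0"
      then have "complex_of_real (real b * \<sigma> + real k + 1) = 0" by simp
      then have "real b * \<sigma> + real k + 1 = 0" by (simp only: of_real_eq_0_iff)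
      then have "\<sigma> = - (real k + 1) / real b" using b0 by (simp add: field_simps)
      with elim that show False by auto
    qed
    then show ?case using elim by (simp add: regular_points_def half_plane_def)
  qed
qed

text \<open>The behaviour of \<open>Z\<close> at the abscissa is reduced to the flat part and to the scalar coefficients of the Taylor terms; the remainder part has
order at most 1 and disappears.\<close>
lemma Z_tendsto:
  assumes \<alpha>: "\<alpha> > 1"
    and flat_part: "((\<lambda>\<sigma>. of_real (\<epsilon> \<sigma> powr \<alpha>) * flat_part (of_real \<sigma>)) \<longlongrightarrow> d) at_abscissa"
    and c: "\<And>k. k < b \<Longrightarrow> ((\<lambda>\<sigma>. (1 + (-1) ^ k) * (\<epsilon> \<sigma> powr (\<alpha> - 1) / (real b * \<sigma> + real k + 1))) \<longlongrightarrow> c k) at_abscissa"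
  shows "((\<lambda>\<sigma>. of_real (\<epsilon> \<sigma> powr \<alpha>) * Z (of_real \<sigma>)) \<longlongrightarrow> d + of_real (\<Sum>k<b. c k / fact k * (2 * \<psi> k 0))) at_abscissa"
proof -
  have "((\<lambda>\<sigma>. of_real (\<epsilon> \<sigma> powr \<alpha>) * flat_part (of_real \<sigma>) + of_real (\<epsilon> \<sigma> powr \<alpha>) * remainder_part (of_real \<sigma>)
     + (\<Sum>k<b. of_real (\<epsilon> \<sigma> powr \<alpha>) * taylor_term k (of_real \<sigma>))) \<longlongrightarrow> d + 0 + (\<Sum>k<b. of_real (c k / fact k * (2 * \<psi> k 0)))) at_abscissa"
    by (intro tendsto_add flat_part remainder_part_tendsto[OF \<alpha>] tendsto_sum taylor_term_tendsto[OF \<alpha>] c) auto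
  moreover have "eventually (\<lambda>\<sigma>. of_real (\<epsilon> \<sigma> powr \<alpha>) * flat_part (of_real \<sigma>) + of_real (\<epsilon> \<sigma> powr \<alpha>) * remainder_part (of_real \<sigma>)
     + (\<Sum>k<b. of_real (\<epsilon> \<sigma> powr \<alpha>) * taylor_term k (of_real \<sigma>)) = of_real (\<epsilon> \<sigma> powr \<alpha>) * Z (of_real \<sigma>)) at_abscissa"
    using eventually_in_regular_points
    by eventually_elim (simp add: Z_eq continuation_def distrib_left sum_distrib_left)
  ultimately have "((\<lambda>\<sigma>. of_real (\<epsilon> \<sigma> powr \<alpha>) * Z (of_real \<sigma>)) \<longlongrightarrow> d + 0 + (\<Sum>k<b. of_real (c k / fact k * (2 * \<psi> k 0)))) at_abscissa"
    by (rule Lim_transform_eventually)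
  then show ?thesis by (simp only: of_real_sum add_0_right)
qed

lemma odd_integer_quotient:
  assumes "odd_integer (real b / real a)"
  shows "real b = real a * (real (b div a - 1) + 1)" "even (b div a - 1)"
proof -
  obtain k :: int where k: "odd k" "real b / real a = of_int k" using assms by (auto simp: odd_integer_def)
  then have "real b = of_int (k * int a)" using a0 by (simp add: field_simps)
  then have ka: "int b = k * int a" by (metis of_int_eq_iff of_int_of_nat_eq)
  have kpos: "k > 0" using ka a0 b0 by (metis mult_le_0_iff not_le of_nat_0_le_iff of_nat_0_less_iff)
  define n where "n = nat k"
  have n: "b = n * a" "odd n" "n > 0" using ka kpos k(1) by (auto simp: n_def even_nat_iff nat_mult_distrib simp flip: int_eq_iff of_nat_mult) (metis int_nat_eq of_nat_eq_iff of_nat_mult less_imp_le)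
  have "b div a = n" using n a0 by simp
  with n show "real b = real a * (real (b div a - 1) + 1)" "even (b div a - 1)"
    by (auto simp: of_nat_diff)
qed

lemma odd_integer_if_resonant:
  assumes "even k" "real b = real a * (real k + 1)"
  shows "odd_integer (real b / real a)"
  unfolding odd_integer_def using assms a0 by (intro exI[of _ "int k + 1"]) simp

lemma \<psi>_eq_partial: "\<psi> m 0 = partial_y0 m \<phi>"
  using smooth_iter_deriv_along_line[OF smooth, of m "(0, 0)" "(0, 1)"] by (simp add: \<psi>_def partial_y0_def)

text \<open>Either no Taylor term is resonant, or $1+\delta>2$; in both cases only the flat part survives the scaling.\<close>
lemma Z_limit_generic:
  assumes "p < real b / real a - 1 \<or> \<not> odd_integer (real b / real a)"
  shows "((\<lambda>\<sigma>. of_real (\<epsilon> \<sigma> powr (1 + (real b / real a - 1) / p)) * Z (of_real \<sigma>))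
     \<longlongrightarrow> of_real (- 4 * leading_const a b q p * \<phi> (0, 0))) at_abscissa"
proof -
  let ?\<alpha> = "1 + (real b / real a - 1) / p"
  have "a \<noteq> b"
  proof
    assume "a = b"
    then show False using assms p0 a0 odd_integer_if_resonant[of 0] by auto
  qed
  then have ba: "real b > real a" using ab by simp
  have \<alpha>: "?\<alpha> > 1" using ba a0 p0 by simp
  have k: "odd k \<or> real b \<noteq> real a * (real k + 1) \<or> ?\<alpha> > 2" for k
  proof (cases "p < real b / real a - 1")
    case False
    then show ?thesis using assms odd_integer_if_resonant by blast
  qed (use p0 in \<open>simp add: less_divide_eq\<close>)
  from Z_tendsto[OF \<alpha> flat_part_tendsto[OF ba] taylor_term_coeff_tendsto_0[OF \<alpha> k]] show ?thesis by simp
qed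

text \<open>Exactly one Taylor term, that of degree $b/a-1$, contributes at order 2.\<close>
lemma Z_limit_resonant:
  assumes odd: "odd_integer (real b / real a)"
    and flat_part: "((\<lambda>\<sigma>. of_real (\<epsilon> \<sigma> powr 2) * flat_part (of_real \<sigma>)) \<longlongrightarrow> of_real d) at_abscissa"
  defines "m \<equiv> b div a - 1"
  shows "((\<lambda>\<sigma>. of_real ((\<epsilon> \<sigma>) ^ 2) * Z (of_real \<sigma>))
     \<longlongrightarrow> of_real (d + 4 * real a / (real b * fact m) * partial_y0 m \<phi>)) at_abscissa"
proof -
  have m: "real b = real a * (real m + 1)" "even m" using odd_integer_quotient[OF odd] by (simp_all add: m_def)
  have mb: "m < b"
  proof -
    have "real m + 1 \<le> real a * (real m + 1)" using a2 by simp
    then show ?thesis using m(1) by linarith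
  qed
  define c where "c k = (if k = m then 2 * real a / real b else 0)" for k
  have c: "((\<lambda>\<sigma>. (1 + (-1) ^ k) * (\<epsilon> \<sigma> powr (2 - 1) / (real b * \<sigma> + real k + 1))) \<longlongrightarrow> c k) at_abscissa" for k
  proof (cases "k = m")
    case True
    then show ?thesis using taylor_term_coeff_tendsto_resonant[OF m(2,1)] by (simp add: c_def)
  next
    case False
    then have "real b \<noteq> real a * (real k + 1)" using m(1) a0 by auto
    then show ?thesis using taylor_term_coeff_tendsto_0[of 2 k] False by (simp add: c_def)
  qed
  have "((\<lambda>\<sigma>. of_real (\<epsilon> \<sigma> powr 2) * Z (of_real \<sigma>)) \<longlongrightarrow> of_real d + of_real (\<Sum>k<b. c k / fact k * (2 * \<psi> k 0))) at_abscissa"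
    by (rule Z_tendsto[OF _ flat_part c]) simp
  also have "(\<Sum>k<b. c k / fact k * (2 * \<psi> k 0)) = (\<Sum>k<b. if k = m then 4 * real a / (real b * fact m) * \<psi> m 0 else 0)"
    by (intro sum.cong) (auto simp: c_def)
  also have "\<dots> = 4 * real a / (real b * fact m) * partial_y0 m \<phi>"
    using mb by (simp add: \<psi>_eq_partial)
  finally have lim: "((\<lambda>\<sigma>. of_real (\<epsilon> \<sigma> powr 2) * Z (of_real \<sigma>)) \<longlongrightarrow> of_real (d + 4 * real a / (real b * fact m) * partial_y0 m \<phi>)) at_abscissa"
    by (simp only: of_real_add)
  have "eventually (\<lambda>\<sigma>. of_real (\<epsilon> \<sigma> powr 2) * Z (of_real \<sigma>) = of_real ((\<epsilon> \<sigma>) ^ 2) * Z (of_real \<sigma>)) at_abscissa"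
    using eventually_at_abscissa
  proof eventually_elim
    case (elim \<sigma>)
    have "\<epsilon> \<sigma> > 0" using eps_pos elim by simp
    then show ?case by simp
  qed
  with lim show ?thesis by (rule Lim_transform_eventually)
qed

lemma Z_limit_critical:
  assumes p: "p = real b / real a - 1" and odd: "odd_integer (real b / real a)"
  shows "((\<lambda>\<sigma>. of_real ((\<epsilon> \<sigma>) ^ 2) * Z (of_real \<sigma>))
     \<longlongrightarrow> of_real (- (4 * real q / p) * \<phi> (0, 0) + 4 * real a / (real b * fact (b div a - 1)) * partial_y0 (b div a - 1) \<phi>)) at_abscissa"
proof (rule Z_limit_resonant[OF odd])
  have d1: "(real b / real a - 1) / p = 1" unfolding p[symmetric] using p0 by simp
  have "1 < real b / real a" using p p0 by linarith
  then have ba: "real b > real a" using a0 by (simp only: less_divide_eq_1_pos)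
  have "leading_const a b q p = real q / p"
    unfolding leading_const_def d1 p[symmetric] using q0 by (simp add: Gamma_numeral)
  with flat_part_tendsto[OF ba] show "((\<lambda>\<sigma>. of_real (\<epsilon> \<sigma> powr 2) * flat_part (of_real \<sigma>)) \<longlongrightarrow> of_real (- (4 * real q / p) * \<phi> (0, 0))) at_abscissa"
    unfolding d1 by simp
qed

lemma Z_limit_supercritical:
  assumes "p > real b / real a - 1" and odd: "odd_integer (real b / real a)"
  shows "((\<lambda>\<sigma>. of_real ((\<epsilon> \<sigma>) ^ 2) * Z (of_real \<sigma>))
     \<longlongrightarrow> of_real (4 * real a / (real b * fact (b div a - 1)) * partial_y0 (b div a - 1) \<phi>)) at_abscissa"
  using Z_limit_resonant[OF odd, of 0] flat_part_tendsto_0[OF assms(1)] by simp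

end

section \<open>The theorem\<close>

theorem theorem3p1:
  fixes a b q :: nat and p :: real
  assumes "2 \<le> a" and "a \<le> b"
    and "p > 0"
    and "even q" and "2 \<le> q" and "q \<le> a"
  shows "\<exists>R>0. \<forall>U. open U \<and> (0, 0) \<in> U \<and> U \<subseteq> ball (0, 0) R \<longrightarrow>
    (\<forall>\<phi> \<in> test_functions U.
      local_zeta (phase a b q p) \<phi> holomorphic_on {s. Re s > 0} \<and>
      (\<exists>Z :: complex \<Rightarrow> complex.
        Z nicely_meromorphic_on {s. Re s > - 1 / real a} \<and>
        (\<forall>s. Re s > 0 \<longrightarrow> Z s = local_zeta (phase a b q p) \<phi> s) \<and>
        {s. Re s > - 1 / real a \<and> is_pole Z s}
          \<subseteq> {complex_of_real (- real j / real b) | j::nat. 1 \<le> j \<and> real j < real b / real a} \<and>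
        ((0 < p \<and> p < real b / real a - 1) \<or> \<not> odd_integer (real b / real a) \<longrightarrow>
          ((\<lambda>\<sigma>::real.
              complex_of_real ((real a * \<sigma> + 1) powr (1 + (real b / real a - 1) / p))
                * Z (complex_of_real \<sigma>))
            \<longlongrightarrow> complex_of_real (- 4 * leading_const a b q p * \<phi> (0, 0)))
          (at_right (- 1 / real a))) \<and>
        (p = real b / real a - 1 \<and> odd_integer (real b / real a) \<longrightarrow>
          (let m = b div a - 1 in
            ((\<lambda>\<sigma>::real. complex_of_real ((real a * \<sigma> + 1) ^ 2) * Z (complex_of_real \<sigma>))
              \<longlongrightarrow> complex_of_real
                (- (4 * real q / p) * \<phi> (0, 0)
                  + 4 * real a / (real b * fact m) * partial_y0 m \<phi>))
            (at_right (- 1 / real a)))) \<and>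
        (p > real b / real a - 1 \<and> odd_integer (real b / real a) \<longrightarrow>
          (let m = b div a - 1 in
            ((\<lambda>\<sigma>::real. complex_of_real ((real a * \<sigma> + 1) ^ 2) * Z (complex_of_real \<sigma>))
              \<longlongrightarrow> complex_of_real
                (4 * real a / (real b * fact m) * partial_y0 m \<phi>))
            (at_right (- 1 / real a))))))"
proof (intro exI[of _ "1::real"] conjI allI impI ballI, simp)
  fix U :: "(real \<times> real) set" and \<phi> :: "real \<times> real \<Rightarrow> real"
  assume U: "open U \<and> (0, 0) \<in> U \<and> U \<subseteq> ball (0, 0) 1" and \<phi>: "\<phi> \<in> test_functions U"
  interpret flat_perturbation a b q p \<phi>
  proof
    show "smooth \<phi>" using \<phi> by (simp add: test_functions_def)
    fix x y :: real assume "\<phi> (x, y) \<noteq> 0"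
    then have "(x, y) \<in> closure (support_on UNIV \<phi>)"
      using closure_subset by (force simp: support_on_def)
    then have "(x, y) \<in> ball (0, 0) 1" using \<phi> U by (auto simp: test_functions_def)
    then have "dist (x, y) (0, 0) < 1" by (simp add: dist_commute)
    then have "norm (x, y) < 1" by (simp add: dist_norm)
    then show "\<bar>x\<bar> \<le> 1 \<and> \<bar>y\<bar> \<le> 1"
      using norm_fst_le[of x y] norm_snd_le[of y x] by simp
  qed (use assms in auto)
  show "local_zeta (phase a b q p) \<phi> holomorphic_on {s. Re s > 0}" by (rule local_zeta_holomorphic)
  show "\<exists>Z :: complex \<Rightarrow> complex.
        Z nicely_meromorphic_on {s. Re s > - 1 / real a} \<and>
        (\<forall>s. Re s > 0 \<longrightarrow> Z s = local_zeta (phase a b q p) \<phi> s) \<and>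
        {s. Re s > - 1 / real a \<and> is_pole Z s}
          \<subseteq> {complex_of_real (- real j / real b) | j::nat. 1 \<le> j \<and> real j < real b / real a} \<and>
        ((0 < p \<and> p < real b / real a - 1) \<or> \<not> odd_integer (real b / real a) \<longrightarrow>
          ((\<lambda>\<sigma>::real.
              complex_of_real ((real a * \<sigma> + 1) powr (1 + (real b / real a - 1) / p))
                * Z (complex_of_real \<sigma>))
            \<longlongrightarrow> complex_of_real (- 4 * leading_const a b q p * \<phi> (0, 0)))
          (at_right (- 1 / real a))) \<and>
        (p = real b / real a - 1 \<and> odd_integer (real b / real a) \<longrightarrow>
          (let m = b div a - 1 in
            ((\<lambda>\<sigma>::real. complex_of_real ((real a * \<sigma> + 1) ^ 2) * Z (complex_of_real \<sigma>))
              \<longlongrightarrow> complex_of_real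
                (- (4 * real q / p) * \<phi> (0, 0)
                  + 4 * real a / (real b * fact m) * partial_y0 m \<phi>))
            (at_right (- 1 / real a)))) \<and>
        (p > real b / real a - 1 \<and> odd_integer (real b / real a) \<longrightarrow>
          (let m = b div a - 1 in
            ((\<lambda>\<sigma>::real. complex_of_real ((real a * \<sigma> + 1) ^ 2) * Z (complex_of_real \<sigma>))
              \<longlongrightarrow> complex_of_real
                (4 * real a / (real b * fact m) * partial_y0 m \<phi>))
            (at_right (- 1 / real a))))"
    unfolding Let_def
  proof (intro exI[of _ Z] conjI allI impI)
    show "Z nicely_meromorphic_on {s. Re s > - 1 / real a}"
      using Z_nicely_meromorphic by (simp add: half_plane_def)
    show "Z s = local_zeta (phase a b q p) \<phi> s" if "Re s > 0" for s
      using that by (simp add: Z_eq Re_pos_in_regular_points local_zeta_eq)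
    show "{s. Re s > - 1 / real a \<and> is_pole Z s}
          \<subseteq> {complex_of_real (- real j / real b) | j::nat. 1 \<le> j \<and> real j < real b / real a}"
      using half_plane_minus_regular_points Z_pole by (force simp: half_plane_def)
  qed (use Z_limit_generic Z_limit_critical Z_limit_supercritical in \<open>auto simp: \<epsilon>_def\<close>)
qed

end
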